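(* Let $1\le k<n$ and let $f\in C^\infty(n,n)$ be a $k$-Morin singularity, with $\lambda$ the determinant of its Jacobi matrix and $\eta$ a null vector field. (a) If $k=1$, then $f$ is $\mathcal{A}$-isotopic to $f^1_{1}$. (b) If $k$ is even, then $f$ is $\mathcal{A}$-isotopic to $f^k_{(\varepsilon_1,1)}$, where $\varepsilon_1=\operatorname{sgn}(\eta^{k}\lambda(0))$; the two germs $f^k_{(1,1)}$ and $f^k_{(-1,1)}$ are not $\mathcal{A}$-isotopic. (c) If $k\geq 3$ is odd, then $f$ is $\mathcal{A}$-isotopic to $f^k_{(1,1)}$.
   Context: All germs are $C^\infty$, and $C^\infty(m,n)$ denotes the set of map-germs $(\mathbb{R}^m,0)\to(\mathbb{R}^n,0)$. Two germs are $\mathcal{A}$-equivalent if $g=\tau\circ f\circ\sigma$ for diffeomorphism-germs $\sigma,\tau$ of source and target at $0$. A germ $f$ is $r$-determined if every germ with the same $r$-jet at $0$ is $\mathcal{A}$-equivalent to $f$. Let $f,g\in C^\infty(m,n)$ be $\mathcal{A}$-equivalent and $r$-determined. They are $\mathcal{A}$-isotopic if there exist continuous curves $\sigma:[0,1]\to \mathrm{Diff}^r(m)$ and $\tau:[0,1]\to\mathrm{Diff}^r(n)$ with $\sigma(0),\tau(0)$ the identity and $j^rg(0)=j^r(\tau(1)\circ f\circ\sigma(1))(0)$, where $\mathrm{Diff}^r(m)$ is the space of $r$-jets at $0$ of diffeomorphism-germs of $(\mathbb{R}^m,0)$. Equivalently, there are orientation-preserving diffeomorphism-germs $\sigma^+$,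 $\tau^+$ of source and target with $j^rg(0)=j^r(\tau^+\circ f\circ\sigma^+)(0)$. For $1\le k\le n$, a germ $f\in C^\infty(n,n)$ is a $k$-Morin singularity if it is $\mathcal{A}$-equivalent to $(x_1,\dots,x_n)\mapsto(x_1x_2+x_1^2x_3+\cdots+x_1^{k-1}x_k+x_1^{k+1},\,x_2,\dots,x_n)$ (for $k=1$: $(x_1^2,x_2,\dots,x_n)$). A $k$-Morin singularity is $(k+1)$-determined. For $2\le k\le n$ and $\varepsilon_1,\varepsilon_2\in\{\pm1\}$ put $$f^k_{(\varepsilon_1,\varepsilon_2)}(x)=\big(\varepsilon_1(\varepsilon_2x_2x_1+x_3x_1^2+\cdots+x_kx_1^{k-1}+x_1^{k+1}),\ \varepsilon_2x_2,\ x_3,\dots,x_n\big),$$ and $f^1_{\varepsilon_1}(x)=(\varepsilon_1x_1^2,x_2,\dots,x_n)$. For a Morin singularity $f$, $\lambda$ is the determinant of the Jacobi matrix of $f$ (then $d\lambda(0)\ne0$), and a null vector field $\eta$ is a nowhere vanishing vector field near $0$ in the source with $\eta(p)\in\ker df(p)$ for every $p$ in the singular set $\{\lambda=0\}$. $\eta^j\lambda$ is the $j$-fold directional derivative of $\lambda$ along $\eta$. *)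

theory Defs
  imports "HOL-Analysis.Analysis"
begin

section \<open>Smooth map-germs and their jets\<close>

text \<open>\<open>pderivs [i\<^sub>1, \<dots>, i\<^sub>s] f\<close> is the iterated partial derivative
  \<open>\<partial>\<^sub>i\<^sub>1 \<dots> \<partial>\<^sub>i\<^sub>s f\<close>.\<close>

fun pderivs :: "'m::finite list \<Rightarrow> (real^'m \<Rightarrow> real^'n) \<Rightarrow> real^'m \<Rightarrow> real^'n::finite" where
  "pderivs [] f = f"
| "pderivs (i # is) f = (\<lambda>x. frechet_derivative (pderivs is f) (at x) (axis i 1))"

text \<open>\<open>C\<^sup>\<infinity>\<close> on the open set \<open>U\<close>. Differentiability of the partial derivatives of every
  order makes all of them continuous, so no separate continuity condition is needed.\<close>

definition smooth_on :: "(real^'m::finite) set \<Rightarrow> (real^'m \<Rightarrow> real^'n::finite) \<Rightarrow> bool" where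
  "smooth_on U f \<longleftrightarrow> open U \<and> (\<forall>is. \<forall>x\<in>U. pderivs is f differentiable (at x))"

text \<open>Germs at the origin are represented by total functions; only the values near \<open>0\<close> matter,
  and equality of germs is equality eventually in \<open>nhds 0\<close>.\<close>

definition smooth_germ :: "(real^'m::finite \<Rightarrow> real^'n::finite) \<Rightarrow> bool" where
  "smooth_germ f \<longleftrightarrow> f 0 = 0 \<and> (\<exists>U. 0 \<in> U \<and> smooth_on U f)"

definition diffeo_germ :: "(real^'m::finite \<Rightarrow> real^'m) \<Rightarrow> bool" where
  "diffeo_germ \<sigma> \<longleftrightarrow> smooth_germ \<sigma> \<and>
     (\<exists>\<rho>. smooth_germ \<rho> \<and> (\<forall>\<^sub>F x in nhds 0. \<rho> (\<sigma> x) = x) \<and> (\<forall>\<^sub>F x in nhds 0. \<sigma> (\<rho> x) = x))"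

definition A_equivalent ::
    "(real^'m::finite \<Rightarrow> real^'n::finite) \<Rightarrow> (real^'m \<Rightarrow> real^'n) \<Rightarrow> bool" where
  "A_equivalent f g \<longleftrightarrow>
     (\<exists>\<sigma> \<tau>. diffeo_germ \<sigma> \<and> diffeo_germ \<tau> \<and> (\<forall>\<^sub>F x in nhds 0. g x = (\<tau> \<circ> f \<circ> \<sigma>) x))"

text \<open>The \<open>r\<close>-jet at \<open>0\<close>, recorded as the family of all partial derivatives of order at most \<open>r\<close>.
  Only finitely many entries are not forced to be zero, so the product topology on families
  induces the usual topology on the finite-dimensional space of \<open>r\<close>-jets.\<close>

definition jet :: "nat \<Rightarrow> (real^'m::finite \<Rightarrow> real^'n::finite) \<Rightarrow> 'm list \<Rightarrow> real^'n" where
  "jet r f = (\<lambda>is. if length is \<le> r then pderivs is f 0 else 0)"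

definition Diff_jets :: "nat \<Rightarrow> ('m::finite list \<Rightarrow> real^'m) set" where
  "Diff_jets r = jet r ` {\<sigma>. diffeo_germ \<sigma>}"

text \<open>The notion is meant for \<open>\<A>\<close>-equivalent, \<open>r\<close>-determined germs \<open>f\<close> and \<open>g\<close>; these standing
  assumptions do not enter the defining condition. The germs \<open>S\<close> and \<open>T\<close> represent the end points
  of the two curves; the jet of the composite does not depend on their choice.\<close>

definition A_isotopic ::
    "nat \<Rightarrow> (real^'m::finite \<Rightarrow> real^'n::finite) \<Rightarrow> (real^'m \<Rightarrow> real^'n) \<Rightarrow> bool" where
  "A_isotopic r f g \<longleftrightarrow>
     (\<exists>(\<sigma> :: real \<Rightarrow> 'm list \<Rightarrow> real^'m) (\<tau> :: real \<Rightarrow> 'n list \<Rightarrow> real^'n).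
        continuous_on {0..1} \<sigma> \<and> \<sigma> ` {0..1} \<subseteq> Diff_jets r \<and> \<sigma> 0 = jet r id \<and>
        continuous_on {0..1} \<tau> \<and> \<tau> ` {0..1} \<subseteq> Diff_jets r \<and> \<tau> 0 = jet r id \<and>
        (\<exists>S T. diffeo_germ S \<and> diffeo_germ T \<and> jet r S = \<sigma> 1 \<and> jet r T = \<tau> 1 \<and>
               jet r g = jet r (T \<circ> f \<circ> S)))"

section \<open>Morin singularities\<close>

text \<open>The linear order on the index type \<open>'n\<close> numbers the coordinates: \<open>ix i\<close> is the \<open>i\<close>-th smallest
  index, so that \<open>x $ ix i\<close> is \<open>x\<^sub>i\<close> for \<open>1 \<le> i \<le> CARD('n)\<close>.\<close>

definition ix :: "nat \<Rightarrow> 'n::{finite,linorder}" where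
  "ix i = sorted_list_of_set UNIV ! (i - 1)"

definition morin_normal_form :: "nat \<Rightarrow> real^'n::{finite,linorder} \<Rightarrow> real^'n::{finite,linorder}" where
  "morin_normal_form k x = (\<chi> i.
     if i = ix 1 then (\<Sum>j=2..k. x $ ix 1 ^ (j - 1) * x $ ix j) + x $ ix 1 ^ (k + 1)
     else x $ i)"

definition morin_singularity :: "nat \<Rightarrow> (real^'n::{finite,linorder} \<Rightarrow> real^'n::{finite,linorder}) \<Rightarrow> bool" where
  "morin_singularity k f \<longleftrightarrow>
     1 \<le> k \<and> k \<le> CARD('n) \<and> smooth_germ f \<and> A_equivalent f (morin_normal_form k)"

text \<open>\<open>f\<^sup>k\<close> with signs \<open>(\<epsilon>\<^sub>1, \<epsilon>\<^sub>2)\<close>, for \<open>2 \<le> k\<close>.\<close>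

definition morin_signed :: "nat \<Rightarrow> real \<Rightarrow> real \<Rightarrow> real^'n::{finite,linorder} \<Rightarrow> real^'n::{finite,linorder}" where
  "morin_signed k \<epsilon>\<^sub>1 \<epsilon>\<^sub>2 x = (\<chi> i.
     if i = ix 1 then
       \<epsilon>\<^sub>1 * (\<epsilon>\<^sub>2 * x $ ix 2 * x $ ix 1 + (\<Sum>j=3..k. x $ ix j * x $ ix 1 ^ (j - 1))
             + x $ ix 1 ^ (k + 1))
     else if i = ix 2 then \<epsilon>\<^sub>2 * x $ ix 2
     else x $ i)"

definition fold_signed :: "real \<Rightarrow> real^'n::{finite,linorder} \<Rightarrow> real^'n::{finite,linorder}" where
  "fold_signed \<epsilon>\<^sub>1 x = (\<chi> i. if i = ix 1 then \<epsilon>\<^sub>1 * (x $ ix 1)\<^sup>2 else x $ i)"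

definition jacobian_det :: "(real^'n \<Rightarrow> real^'n) \<Rightarrow> real^'n \<Rightarrow> real" where
  "jacobian_det f p = det (jacobian f (at p))"

text \<open>A vector field is identified with its coefficient map, which need not vanish at \<open>0\<close>.\<close>

definition null_vector_field :: "(real^'n \<Rightarrow> real^'n) \<Rightarrow> (real^'n \<Rightarrow> real^'n) \<Rightarrow> bool" where
  "null_vector_field f \<eta> \<longleftrightarrow>
     (\<exists>U. 0 \<in> U \<and> smooth_on U \<eta> \<and>
        (\<forall>p\<in>U. \<eta> p \<noteq> 0 \<and> (jacobian_det f p = 0 \<longrightarrow> frechet_derivative f (at p) (\<eta> p) = 0)))"

definition dir_deriv :: "(real^'n \<Rightarrow> real^'n) \<Rightarrow> (real^'n \<Rightarrow> real) \<Rightarrow> real^'n \<Rightarrow> real" where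
  "dir_deriv \<eta> h = (\<lambda>p. frechet_derivative h (at p) (\<eta> p))"

end

theory Submission
  imports Defs
begin

text \<open>Every germ of a diffeomorphism \<open>S\<close> with positive Jacobian determinant is joined to the identity
  through \<open>S(tx)/t\<close>, which contracts it to its linear part, and a path in the connected group of
  matrices of positive determinant. So only the orientations of the two coordinate changes in an
  \<open>\<A>\<close>-equivalence matter. Since \<open>k < n\<close>, reflecting the spare coordinate \<open>x\<^sub>n\<close> in source and target
  reverses both orientations at once; for odd \<open>k\<close> a diagonal symmetry of the normal form reverses
  exactly one, and for even \<open>k\<close> reflecting \<open>y\<^sub>1\<close> turns \<open>\<epsilon>\<^sub>1 = 1\<close> into \<open>\<epsilon>\<^sub>1 = -1\<close>.

  The sign for even \<open>k\<close> is read off along the image of the \<open>x\<^sub>1\<close>-axis: it stays within \<open>O(t\<^sup>k)\<close> of the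
  singular set, so a null vector field is tangent to it up to \<open>o(t\<^sup>k\<^sup>-\<^sup>1)\<close>, and \<open>\<eta>\<^sup>k\<lambda>(0)\<close> is a positive
  multiple of the coefficient of \<open>t\<^sup>k\<close> in \<open>\<lambda>\<close>.\<close>

section \<open>Smooth maps\<close>

text \<open>Two difficulties shape the argument. A null field is prescribed only on the singular set
  and is arbitrary elsewhere, so eta^k lambda(0) cannot be computed with a convenient
  representative. Instead, orders of vanishing are measured by limits of quotients by powers of t
  along a curve. Every derivative along eta costs one power of t, so a curve on which lambda
  vanishes exactly to order k, with tangency error o(t^(k-1)), is just good enough for k
  derivatives. If eta is a_0 times the velocity at 0, a factor a_0^k enters; evenness of k makes it
  positive for either direction of eta. An isotopy controls only r-jets, so invariance of that sign
  under coordinate changes does not by itself separate the two signed forms. Leading coefficients of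
  Jacobian determinants along a curve do: since r >= k + 1, determinants of germs with equal jets
  differ by O(|x|^(k+1)), which is invisible at order t^k. As for the matrix group, its identity
  component is shown through elementary matrices to have index at most two, and the sign of the
  determinant then identifies it.\<close>

text \<open>Directions \<open>v\<close> replace the coordinate indices of \<open>pderivs\<close>, so
  that the same calculus serves curves on the line and functions of a matrix. The derivatives of top
  order need only exist; demanding the property for every \<open>n\<close> gives smoothness.\<close>

fun C_on :: "nat \<Rightarrow> 'a::euclidean_space set \<Rightarrow> ('a \<Rightarrow> 'b::real_normed_vector) \<Rightarrow> bool" where
  "C_on 0 U f \<longleftrightarrow> True"
| "C_on (Suc n) U f \<longleftrightarrow> (\<forall>x\<in>U. f differentiable (at x)) \<and>
     (\<forall>v. C_on n U (\<lambda>x. frechet_derivative f (at x) v))"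

lemma C_on_cong:
  assumes "open U" "\<And>x. x \<in> U \<Longrightarrow> f x = g x"
  shows "C_on n U f \<longleftrightarrow> C_on n U g"
  using assms(2)
proof (induction n arbitrary: f g)
  case (Suc n)
  have ev: "\<forall>\<^sub>F y in nhds x. f y = g y" if "x \<in> U" for x
    using eventually_nhds_in_open[OF assms(1) that] by eventually_elim (rule Suc.prems)
  have d: "(f has_derivative D) (at x) \<longleftrightarrow> (g has_derivative D) (at x)" if "x \<in> U" for x D
    using has_derivative_transform_within_open[OF _ assms(1) that, of f D UNIV g]
      has_derivative_transform_within_open[OF _ assms(1) that, of g D UNIV f] Suc.prems by auto
  then have "frechet_derivative f (at x) = frechet_derivative g (at x)" if "x \<in> U" for x
    using that by (auto simp: frechet_derivative_def)
  moreover have "f differentiable (at x) \<longleftrightarrow> g differentiable (at x)" if "x \<in> U" for x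
    using d that by (auto simp: differentiable_def)
  moreover have "C_on n U (\<lambda>x. frechet_derivative f (at x) v) \<longleftrightarrow> C_on n U (\<lambda>x. frechet_derivative g (at x) v)" for v
    by (rule Suc.IH) (simp add: calculation(1))
  ultimately show ?case by simp
qed simp

lemma C_on_mono: "C_on n U f \<Longrightarrow> V \<subseteq> U \<Longrightarrow> C_on n V f"
  by (induction n arbitrary: f) auto

lemma C_on_SucD: "C_on (Suc n) U f \<Longrightarrow> C_on n U f"
proof (induction n arbitrary: f)
  case (Suc n)
  then show ?case unfolding C_on.simps(2)[of _ U f] by blast
qed simp

lemma C_on_SucI:
  assumes "open U" "\<And>x. x \<in> U \<Longrightarrow> (f has_derivative D x) (at x)"
    and "\<And>v. C_on n U (\<lambda>x. D x v)"
  shows "C_on (Suc n) U f"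
proof -
  have "frechet_derivative f (at x) = D x" if "x \<in> U" for x
    using frechet_derivative_at[OF assms(2)[OF that]] by simp
  then have "C_on n U (\<lambda>x. frechet_derivative f (at x) v)" for v
    by (subst C_on_cong[OF assms(1), of _ "\<lambda>x. D x v"]) (simp_all add: assms(3))
  then show ?thesis using assms(2) by (auto simp: differentiable_def)
qed

lemma C_on_SucE:
  assumes "C_on (Suc n) U f" "x \<in> U"
  shows "(f has_derivative frechet_derivative f (at x)) (at x)"
  using assms frechet_derivative_works by auto

lemma C_on_const: "open U \<Longrightarrow> C_on n U (\<lambda>x. c)"
proof (induction n arbitrary: c)
  case (Suc n)
  show ?case
    by (rule C_on_SucI[OF Suc.prems, where D="\<lambda>_ _. 0"]) (simp_all add: Suc.IH Suc.prems)
qed simp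

lemma C_on_add:
  assumes "open U" "C_on n U f" "C_on n U g"
  shows "C_on n U (\<lambda>x. f x + g x)"
  using assms(2,3)
proof (induction n arbitrary: f g)
  case (Suc n)
  show ?case
  proof (rule C_on_SucI[OF assms(1)])
    fix x assume "x \<in> U"
    then show "((\<lambda>x. f x + g x) has_derivative
        (\<lambda>v. frechet_derivative f (at x) v + frechet_derivative g (at x) v)) (at x)"
      by (intro has_derivative_add C_on_SucE[OF Suc.prems(1)] C_on_SucE[OF Suc.prems(2)])
  qed (use Suc.prems in \<open>simp add: Suc.IH\<close>)
qed simp

lemma C_on_bounded_bilinear:
  assumes "bounded_bilinear B" "open U" "C_on n U f" "C_on n U g"
  shows "C_on n U (\<lambda>x. B (f x) (g x))"
  using assms(3,4)
proof (induction n arbitrary: f g)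
  case (Suc n)
  show ?case
  proof (rule C_on_SucI[OF assms(2)])
    fix x assume "x \<in> U"
    then show "((\<lambda>x. B (f x) (g x)) has_derivative
        (\<lambda>v. B (f x) (frechet_derivative g (at x) v) + B (frechet_derivative f (at x) v) (g x))) (at x)"
      by (intro bounded_bilinear.FDERIV[OF assms(1)] C_on_SucE[OF Suc.prems(1)] C_on_SucE[OF Suc.prems(2)])
  next
    fix v
    show "C_on n U (\<lambda>x. B (f x) (frechet_derivative g (at x) v) + B (frechet_derivative f (at x) v) (g x))"
      using Suc.prems C_on_SucD[OF Suc.prems(1)] C_on_SucD[OF Suc.prems(2)]
      by (intro C_on_add assms(2) Suc.IH) simp_all
  qed
qed simp

lemma C_on_sum:
  assumes "open U" "\<And>i. i \<in> I \<Longrightarrow> C_on n U (f i)"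
  shows "C_on n U (\<lambda>x. \<Sum>i\<in>I. f i x)"
  using assms(2)
  by (induction I rule: infinite_finite_induct) (auto intro: C_on_const C_on_add assms(1))

lemma C_on_compose:
  fixes g :: "'a::euclidean_space \<Rightarrow> 'c::euclidean_space"
  assumes "open U" "open V" "g ` U \<subseteq> V" "C_on n V f" "C_on n U g"
  shows "C_on n U (\<lambda>x. f (g x))"
  using assms(4,5)
proof (induction n arbitrary: f)
  case (Suc n)
  let ?D = "\<lambda>x v. frechet_derivative f (at (g x)) (frechet_derivative g (at x) v)"
  show ?case
  proof (rule C_on_SucI[OF assms(1)])
    fix x assume x: "x \<in> U"
    then have "g x \<in> V" using assms(3) by auto
    then show "((\<lambda>x. f (g x)) has_derivative ?D x) (at x)"
      using has_derivative_compose[OF C_on_SucE[OF Suc.prems(2) x] C_on_SucE[OF Suc.prems(1)]] by simp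
  next
    fix v
    \<comment> \<open>In the chain rule the outer derivative is taken in a direction that moves with
      \<open>x\<close>, while \<open>C_on\<close> speaks of fixed directions. Expanding in the basis
      turns it into a sum of products to which the induction hypothesis applies.\<close>
    have eq: "?D x v = (\<Sum>b\<in>Basis. (frechet_derivative g (at x) v \<bullet> b) *\<^sub>R frechet_derivative f (at (g x)) b)"
      if "x \<in> U" for x
    proof -
      have "linear (frechet_derivative f (at (g x)))"
        using Suc.prems(1) that assms(3) linear_frechet_derivative by auto
      then show ?thesis
        by (subst (1) euclidean_representation[symmetric, of "frechet_derivative g (at x) v"])
          (simp only: linear_sum linear_scale)
    qed
    have "C_on n U (\<lambda>x. \<Sum>b\<in>Basis. (frechet_derivative g (at x) v \<bullet> b) *\<^sub>R frechet_derivative f (at (g x)) b)"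
    proof (intro C_on_sum C_on_bounded_bilinear[OF bounded_bilinear_scaleR] assms(1))
      fix b :: 'c
      show "C_on n U (\<lambda>x. frechet_derivative g (at x) v \<bullet> b)"
        using Suc.prems by (intro C_on_bounded_bilinear[OF bounded_bilinear_inner] C_on_const assms(1)) auto
      show "C_on n U (\<lambda>x. frechet_derivative f (at (g x)) b)"
        using Suc C_on_SucD[of n U g] by auto
    qed
    then show "C_on n U (\<lambda>x. ?D x v)"
      by (subst C_on_cong[OF assms(1) eq]) simp_all
  qed
qed simp

section \<open>Smoothness near a point\<close>

text \<open>A single neighbourhood serves all orders, as in \<open>smooth_on\<close>. This makes
  smoothness an open condition, which is what lets identities of germs be differentiated near the
  point and not only at it.\<close>

definition smooth_at :: "('a::euclidean_space \<Rightarrow> 'b::real_normed_vector) \<Rightarrow> 'a \<Rightarrow> bool" where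
  "smooth_at f a \<longleftrightarrow> (\<exists>U. open U \<and> a \<in> U \<and> (\<forall>n. C_on n U f))"

lemma smooth_at_common:
  assumes "smooth_at f a" "smooth_at g a"
  obtains U where "open U" "a \<in> U" "\<And>n. C_on n U f" "\<And>n. C_on n U g"
proof -
  obtain U V where U: "open U" "a \<in> U" "\<And>n. C_on n U f"
    and V: "open V" "a \<in> V" "\<And>n. C_on n V g"
    using assms unfolding smooth_at_def by blast
  show ?thesis
    by (rule that[OF open_Int[OF U(1) V(1)] _ C_on_mono[OF U(3)] C_on_mono[OF V(3)]]) (use U V in auto)
qed

lemma smooth_at_transform:
  assumes "smooth_at f a" "\<forall>\<^sub>F x in nhds a. f x = g x"
  shows "smooth_at g a"
proof -
  obtain U where U: "open U" "a \<in> U" "\<And>n. C_on n U f"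
    using assms(1) unfolding smooth_at_def by blast
  obtain V where V: "open V" "a \<in> V" "\<forall>x\<in>V. f x = g x"
    using assms(2) unfolding eventually_nhds by blast
  have "C_on n (U \<inter> V) g" for n
    using C_on_cong[THEN iffD1, OF open_Int[OF U(1) V(1)] _ C_on_mono[OF U(3)], of g n] V(3) by blast
  moreover have "open (U \<inter> V)" "a \<in> U \<inter> V" using U V by auto
  ultimately show ?thesis unfolding smooth_at_def by blast
qed

lemma eventually_smooth_at: "smooth_at f a \<Longrightarrow> \<forall>\<^sub>F x in nhds a. smooth_at f x"
  unfolding smooth_at_def eventually_nhds by blast

lemma smooth_at_has_derivative:
  "smooth_at f a \<Longrightarrow> (f has_derivative frechet_derivative f (at a)) (at a)"
  unfolding smooth_at_def using C_on_SucE[of 0] by blast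

lemma smooth_at_differentiable: "smooth_at f a \<Longrightarrow> f differentiable (at a)"
  using smooth_at_has_derivative differentiable_def by blast

lemma smooth_at_continuous: "smooth_at f a \<Longrightarrow> continuous (at a) f"
  by (simp add: differentiable_imp_continuous_within smooth_at_differentiable)

lemma smooth_at_frechet:
  "smooth_at f a \<Longrightarrow> smooth_at (\<lambda>x. frechet_derivative f (at x) v) a"
proof -
  assume "smooth_at f a"
  then obtain U where U: "open U" "a \<in> U" "\<And>n. C_on n U f" unfolding smooth_at_def by blast
  have "C_on n U (\<lambda>x. frechet_derivative f (at x) v)" for n using U(3)[of "Suc n"] by simp
  then show ?thesis using U unfolding smooth_at_def by blast
qed

lemma smooth_at_const [simp]: "smooth_at (\<lambda>x. c) a"
  by (auto simp: smooth_at_def intro: C_on_const)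

lemma smooth_at_bounded_bilinear:
  assumes "bounded_bilinear B" "smooth_at f a" "smooth_at g a"
  shows "smooth_at (\<lambda>x. B (f x) (g x)) a"
proof -
  obtain U where "open U" "a \<in> U" "\<And>n. C_on n U f" "\<And>n. C_on n U g"
    using smooth_at_common[OF assms(2,3)] by blast
  moreover from this have "C_on n U (\<lambda>x. B (f x) (g x))" for n
    by (intro C_on_bounded_bilinear[OF assms(1)])
  ultimately show ?thesis unfolding smooth_at_def by blast
qed

lemma smooth_at_add:
  assumes "smooth_at f a" "smooth_at g a"
  shows "smooth_at (\<lambda>x. f x + g x) a"
proof -
  obtain U where "open U" "a \<in> U" "\<And>n. C_on n U f" "\<And>n. C_on n U g"
    using smooth_at_common[OF assms(1,2)] by blast
  moreover from this have "C_on n U (\<lambda>x. f x + g x)" for n by (intro C_on_add)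
  ultimately show ?thesis unfolding smooth_at_def by blast
qed

lemma smooth_at_sum: "(\<And>i. i \<in> I \<Longrightarrow> smooth_at (f i) a) \<Longrightarrow> smooth_at (\<lambda>x. \<Sum>i\<in>I. f i x) a"
  by (induction I rule: infinite_finite_induct) (simp_all add: smooth_at_add)

lemma smooth_at_mult:
  fixes f g :: "'a::euclidean_space \<Rightarrow> real"
  shows "smooth_at f a \<Longrightarrow> smooth_at g a \<Longrightarrow> smooth_at (\<lambda>x. f x * g x) a"
  by (rule smooth_at_bounded_bilinear[OF bounded_bilinear_mult])

lemma smooth_at_prod:
  fixes f :: "'i \<Rightarrow> 'a::euclidean_space \<Rightarrow> real"
  shows "(\<And>i. i \<in> I \<Longrightarrow> smooth_at (f i) a) \<Longrightarrow> smooth_at (\<lambda>x. \<Prod>i\<in>I. f i x) a"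
  by (induction I rule: infinite_finite_induct) (simp_all add: smooth_at_mult)

lemma smooth_at_power:
  fixes f :: "'a::euclidean_space \<Rightarrow> real"
  shows "smooth_at f a \<Longrightarrow> smooth_at (\<lambda>x. f x ^ n) a"
  by (induction n) (simp_all add: smooth_at_mult)

lemma smooth_at_scaleR:
  "smooth_at f a \<Longrightarrow> smooth_at g a \<Longrightarrow> smooth_at (\<lambda>x. f x *\<^sub>R g x) a"
  by (rule smooth_at_bounded_bilinear[OF bounded_bilinear_scaleR])

lemma smooth_at_diff:
  assumes "smooth_at f a" "smooth_at g a"
  shows "smooth_at (\<lambda>x. f x - g x) a"
  using smooth_at_add[OF assms(1) smooth_at_scaleR[OF smooth_at_const[of "-1"] assms(2)]] by simp

lemma smooth_at_linear:
  fixes f :: "'a::euclidean_space \<Rightarrow> 'b::real_normed_vector"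
  assumes "bounded_linear f"
  shows "smooth_at f a"
proof -
  have "C_on (Suc n) UNIV f" for n
    by (rule C_on_SucI[where D="\<lambda>_. f"]) (simp_all add: bounded_linear_imp_has_derivative assms C_on_const)
  then have "C_on n UNIV f" for n by (rule C_on_SucD)
  then show ?thesis unfolding smooth_at_def by (intro exI[of _ UNIV]) simp
qed

lemma smooth_at_compose:
  fixes g :: "'a::euclidean_space \<Rightarrow> 'c::euclidean_space"
  assumes "smooth_at g a" "smooth_at f (g a)"
  shows "smooth_at (\<lambda>x. f (g x)) a"
proof -
  obtain U V where U: "open U" "a \<in> U" "\<And>n. C_on n U g" and V: "open V" "g a \<in> V" "\<And>n. C_on n V f"
    using assms unfolding smooth_at_def by blast
  have "continuous_on U g"
    using C_on_SucE[OF U(3)[of 1, unfolded One_nat_def]] has_derivative_continuous U(1)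
    by (simp add: continuous_on_eq_continuous_at) blast
  then have "open (U \<inter> g -` V)"
    using U(1) V(1) by (rule continuous_open_preimage)
  moreover have "C_on n (U \<inter> g -` V) (\<lambda>x. f (g x))" for n
    by (rule C_on_compose[OF \<open>open (U \<inter> g -` V)\<close> V(1) _ V(3) C_on_mono[OF U(3)]]) auto
  moreover have "a \<in> U \<inter> g -` V" using U(2) V(2) by simp
  ultimately show ?thesis unfolding smooth_at_def by blast
qed

lemma smooth_at_nth: "smooth_at f a \<Longrightarrow> smooth_at (\<lambda>x. f x $ i) a"
  for f :: "'a::euclidean_space \<Rightarrow> 'b::euclidean_space^'n"
  by (rule smooth_at_compose[where f="\<lambda>x. x $ i"]) (simp_all add: smooth_at_linear bounded_linear_vec_nth)

lemma smooth_at_vec: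
  fixes f :: "'n::finite \<Rightarrow> 'a::euclidean_space \<Rightarrow> real"
  assumes "\<And>i. smooth_at (f i) a"
  shows "smooth_at (\<lambda>x. \<chi> i. f i x) a"
proof -
  have "(\<lambda>x. \<chi> i. f i x) = (\<lambda>x. \<Sum>i\<in>UNIV. f i x *\<^sub>R axis i 1)"
    by (auto simp: vec_eq_iff fun_eq_iff axis_def if_distrib cong: if_cong)
  then show ?thesis by (auto intro!: smooth_at_sum smooth_at_scaleR assms)
qed

lemma smooth_at_lipschitz:
  fixes f :: "'a::euclidean_space \<Rightarrow> 'b::euclidean_space"
  assumes "smooth_at f a"
  obtains \<delta> L where "\<delta> > 0" "L \<ge> 0" "\<And>x y. x \<in> ball a \<delta> \<Longrightarrow> y \<in> ball a \<delta> \<Longrightarrow> norm (f x - f y) \<le> L * norm (x - y)"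
proof -
  let ?D = "\<lambda>x. frechet_derivative f (at x)"
  \<comment> \<open>The summand 1 is slack: by continuity each directional derivative stays below
    its norm at \<open>a\<close> plus 1 on a ball, and balls are convex, so the mean value
    inequality applies.\<close>
  define L where "L = (\<Sum>b\<in>Basis. norm (?D a b) + 1)"
  have "\<forall>\<^sub>F x in nhds a. norm (?D x b) < norm (?D a b) + 1" for b
  proof -
    have "((\<lambda>x. norm (?D x b)) \<longlongrightarrow> norm (?D a b)) (nhds a)"
      by (rule tendsto_norm[OF tendsto_at_iff_tendsto_nhds[of "\<lambda>x. ?D x b" a, THEN iffD1,
            OF smooth_at_continuous[OF smooth_at_frechet[OF assms, of b], unfolded isCont_def]]])
    then show ?thesis by (rule order_tendstoD) simp
  qed
  then have "\<forall>\<^sub>F x in nhds a. smooth_at f x \<and> (\<forall>b\<in>Basis. norm (?D x b) < norm (?D a b) + 1)"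
    using eventually_smooth_at[OF assms] by (simp add: eventually_conj_iff eventually_ball_finite_distrib)
  then obtain \<delta> where \<delta>: "\<delta> > 0" and
    h: "\<And>x. x \<in> ball a \<delta> \<Longrightarrow> smooth_at f x \<and> (\<forall>b\<in>Basis. norm (?D x b) < norm (?D a b) + 1)"
    unfolding eventually_nhds_metric mem_ball by (metis dist_commute)
  have bd: "onorm (?D x) \<le> L" if x: "x \<in> ball a \<delta>" for x
  proof (rule onorm_le)
    fix v
    have lin: "linear (?D x)" using h[OF x] smooth_at_differentiable linear_frechet_derivative by blast
    have "?D x v = (\<Sum>b\<in>Basis. (v \<bullet> b) *\<^sub>R ?D x b)"
      by (subst (1) euclidean_representation[symmetric, of v]) (simp only: linear_sum[OF lin] linear_scale[OF lin])
    also have "norm \<dots> \<le> (\<Sum>b\<in>Basis. norm v * (norm (?D a b) + 1))"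
      using h[OF x] by (intro order_trans[OF norm_sum] sum_mono)
        (auto intro!: mult_mono simp: Basis_le_norm less_imp_le)
    also have "\<dots> = L * norm v" by (simp add: L_def sum_distrib_left mult.commute)
    finally show "norm (?D x v) \<le> L * norm v" .
  qed
  show ?thesis
  proof (rule that[OF \<delta>])
    show "L \<ge> 0" by (auto simp: L_def intro!: sum_nonneg)
    fix x y assume x: "x \<in> ball a \<delta>" and y: "y \<in> ball a \<delta>"
    have "(f has_derivative ?D z) (at z within ball a \<delta>)" if "z \<in> ball a \<delta>" for z
      using h[OF that] by (simp add: smooth_at_has_derivative has_derivative_at_withinI)
    then show "norm (f x - f y) \<le> L * norm (x - y)"
      using bd x y by (intro differentiable_bound[OF convex_ball])
  qed
qed

section \<open>Partial derivatives and jets\<close>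

lemma pderivs_append: "pderivs (is @ js) f = pderivs is (pderivs js f)"
  by (induction "is") simp_all

lemma linear_eq_sum_axis:
  fixes D :: "real^'m::finite \<Rightarrow> 'b::real_vector"
  assumes "linear D"
  shows "D v = (\<Sum>i\<in>UNIV. v $ i *\<^sub>R D (axis i 1))"
proof -
  have "D v = D (\<Sum>i\<in>UNIV. v $ i *\<^sub>R axis i 1)"
    by (rule arg_cong[where f=D]) (simp add: vec_eq_iff axis_def if_distrib[of "\<lambda>y. _ * y"] cong: if_cong)
  then show ?thesis by (simp add: linear_sum[OF assms] linear_scale[OF assms])
qed

lemma smooth_on_imp_C_on:
  assumes "smooth_on U f"
  shows "C_on n U f"
  using assms
proof (induction n arbitrary: f)
  case (Suc n)
  have U: "open U" and d: "\<And>is x. x \<in> U \<Longrightarrow> pderivs is f differentiable (at x)"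
    using Suc.prems by (auto simp: smooth_on_def)
  have f: "f differentiable (at x)" if "x \<in> U" for x using d[OF that, of "[]"] by simp
  have "smooth_on U (pderivs [i] f)" for i
    unfolding smooth_on_def pderivs_append[symmetric] using U d by blast
  then have part: "C_on n U (\<lambda>x. frechet_derivative f (at x) (axis i 1))" for i
    using Suc.IH[of "pderivs [i] f"] by simp
  have sm: "C_on n U (\<lambda>x. \<Sum>i\<in>UNIV. v $ i *\<^sub>R frechet_derivative f (at x) (axis i 1))" for v
    by (intro C_on_sum C_on_bounded_bilinear[OF bounded_bilinear_scaleR] C_on_const part U)
  have eq: "frechet_derivative f (at x) v = (\<Sum>i\<in>UNIV. v $ i *\<^sub>R frechet_derivative f (at x) (axis i 1))"
    if "x \<in> U" for x v
    by (rule linear_eq_sum_axis) (rule linear_frechet_derivative[OF f[OF that]])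
  have "C_on n U (\<lambda>x. frechet_derivative f (at x) v)" for v
    by (rule C_on_cong[OF U, THEN iffD2, OF eq sm])
  then show ?case using f by simp
qed simp

text \<open>\<open>pderivs\<close> applies the last index of its list first, whereas
  \<open>C_on\<close> peels off the first derivative taken; hence the induction from the end of the
  list.\<close>

lemma C_on_imp_smooth_on:
  assumes "open U" "\<And>n. C_on n U f"
  shows "smooth_on U f"
proof -
  have "pderivs is f differentiable (at x)" if "x \<in> U" for x "is"
    using assms(2)
  proof (induction "is" arbitrary: f rule: rev_induct)
    case Nil
    then show ?case using C_on.simps(2)[of 0 U f] that by simp
  next
    case (snoc i "is")
    have "C_on n U (\<lambda>x. frechet_derivative f (at x) (axis i 1))" for n
      using snoc.prems[of "Suc n"] by simp
    from snoc.IH[OF this] show ?case by (simp add: pderivs_append)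
  qed
  then show ?thesis using assms(1) by (simp add: smooth_on_def)
qed

lemma smooth_germ_iff: "smooth_germ f \<longleftrightarrow> f 0 = 0 \<and> smooth_at f 0"
  unfolding smooth_germ_def smooth_at_def
  using smooth_on_imp_C_on C_on_imp_smooth_on smooth_on_def by metis

lemma smooth_at_pderivs: "smooth_at f a \<Longrightarrow> smooth_at (pderivs is f) a"
  by (induction "is") (simp_all add: smooth_at_frechet)

lemma frechet_derivative_cong:
  assumes "\<forall>\<^sub>F x in nhds a. f x = g x"
  shows "frechet_derivative f (at a) = frechet_derivative g (at a)"
proof -
  obtain U where U: "open U" "a \<in> U" "\<And>x. x \<in> U \<Longrightarrow> f x = g x"
    using assms unfolding eventually_nhds by blast
  have "(f has_derivative D) (at a) \<longleftrightarrow> (g has_derivative D) (at a)" for D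
    using has_derivative_transform_within_open[OF _ U(1,2), of f D UNIV g]
      has_derivative_transform_within_open[OF _ U(1,2), of g D UNIV f] U(3) by auto
  then show ?thesis by (simp add: frechet_derivative_def)
qed

text \<open>The conclusion is kept on a neighbourhood, because equality at \<open>a\<close> alone
  would not survive the next derivative; \<open>eventually_eventually\<close> provides agreement
  around each nearby point.\<close>

lemma pderivs_cong:
  assumes "\<forall>\<^sub>F x in nhds a. f x = g x"
  shows "\<forall>\<^sub>F x in nhds a. pderivs is f x = pderivs is g x"
proof (induction "is")
  case (Cons i "is")
  then have "\<forall>\<^sub>F x in nhds a. \<forall>\<^sub>F y in nhds x. pderivs is f y = pderivs is g y"
    by (simp add: eventually_eventually)
  then show ?case
    by eventually_elim (simp add: frechet_derivative_cong)
qed (simp add: assms)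

lemma jet_cong: "\<forall>\<^sub>F x in nhds 0. f x = g x \<Longrightarrow> jet r f = jet r g"
  unfolding jet_def using eventually_nhds_x_imp_x[OF pderivs_cong] by fastforce

lemma pderivs_diff:
  assumes "smooth_at f a" "smooth_at g a"
  shows "\<forall>\<^sub>F x in nhds a. pderivs is (\<lambda>x. f x - g x) x = pderivs is f x - pderivs is g x"
proof (induction "is")
  case (Cons i "is")
  then have "\<forall>\<^sub>F x in nhds a. \<forall>\<^sub>F y in nhds x. pderivs is (\<lambda>x. f x - g x) y = pderivs is f y - pderivs is g y"
    by (simp add: eventually_eventually)
  then show ?case
    using eventually_smooth_at[OF smooth_at_pderivs[OF assms(1), of "is"]]
      eventually_smooth_at[OF smooth_at_pderivs[OF assms(2), of "is"]]
  proof eventually_elim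
    case (elim x)
    have "((\<lambda>x. pderivs is f x - pderivs is g x) has_derivative
      (\<lambda>v. frechet_derivative (pderivs is f) (at x) v - frechet_derivative (pderivs is g) (at x) v)) (at x)"
      by (intro has_derivative_diff smooth_at_has_derivative elim)
    then have "frechet_derivative (\<lambda>x. pderivs is f x - pderivs is g x) (at x) =
      (\<lambda>v. frechet_derivative (pderivs is f) (at x) v - frechet_derivative (pderivs is g) (at x) v)"
      by (rule frechet_derivative_at[symmetric])
    then show ?case using frechet_derivative_cong[OF elim(1)] by simp
  qed
qed simp

text \<open>Takes the place of the multivariate Taylor formula: the first partial derivatives are
  flat to one order less, and the mean value inequality contributes the missing factor
  \<open>norm x\<close>.\<close>

lemma flat_bound:
  fixes h :: "real^'m::finite \<Rightarrow> real^'n::finite"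
  assumes "smooth_at h 0" "\<And>is. length is \<le> m \<Longrightarrow> pderivs is h 0 = 0"
  shows "\<exists>C\<ge>0. \<forall>\<^sub>F x in nhds 0. norm (h x) \<le> C * norm x ^ Suc m"
  using assms
proof (induction m arbitrary: h)
  case 0
  obtain \<delta> L where "\<delta> > 0" "L \<ge> 0"
    and L: "\<And>x y. x \<in> ball 0 \<delta> \<Longrightarrow> y \<in> ball 0 \<delta> \<Longrightarrow> norm (h x - h y) \<le> L * norm (x - y)"
    using smooth_at_lipschitz[OF 0(1)] by blast
  have "norm (h x) \<le> L * norm x ^ Suc 0" if "dist x 0 < \<delta>" for x
    using L[of x 0] that \<open>\<delta> > 0\<close> 0(2)[of "[]"] by simp
  then show ?case using \<open>\<delta> > 0\<close> \<open>L \<ge> 0\<close> unfolding eventually_nhds_metric by blast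
next
  case (Suc m)
  let ?D = "\<lambda>x. frechet_derivative h (at x)"
  have "\<exists>C\<ge>0. \<forall>\<^sub>F x in nhds 0. norm (?D x (axis i 1)) \<le> C * norm x ^ Suc m" for i
  proof (rule Suc.IH)
    show "pderivs is (\<lambda>x. ?D x (axis i 1)) 0 = 0" if "length is \<le> m" for "is"
      using Suc.prems(2)[of "is @ [i]"] that by (simp add: pderivs_append)
  qed (rule smooth_at_frechet[OF Suc.prems(1)])
  then have "\<forall>i. \<exists>C\<ge>0. \<forall>\<^sub>F x in nhds 0. norm (?D x (axis i 1)) \<le> C * norm x ^ Suc m" ..
  from choice[OF this] obtain C where C: "\<And>i. C i \<ge> 0"
    "\<And>i. \<forall>\<^sub>F x in nhds 0. norm (?D x (axis i 1)) \<le> C i * norm x ^ Suc m" by blast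
  have "\<forall>\<^sub>F x in nhds 0. smooth_at h x \<and> (\<forall>i. norm (?D x (axis i 1)) \<le> C i * norm x ^ Suc m)"
    using eventually_smooth_at[OF Suc.prems(1)] C(2) by (simp add: eventually_conj_iff eventually_all_finite)
  then obtain \<delta> where \<delta>: "\<delta> > 0" and h: "\<And>x. dist x 0 < \<delta> \<Longrightarrow> smooth_at h x"
    "\<And>x i. dist x 0 < \<delta> \<Longrightarrow> norm (?D x (axis i 1)) \<le> C i * norm x ^ Suc m"
    unfolding eventually_nhds_metric by blast
  let ?C = "\<Sum>i\<in>UNIV. C i"
  have "norm (h x) \<le> ?C * norm x ^ Suc (Suc m)" if x: "dist x 0 < \<delta>" for x
  proof -
    \<comment> \<open>On the ball of radius \<open>norm x\<close> every point satisfies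
      \<open>norm y \<le> norm x\<close>, so the bound on the derivative can be expressed through
      \<open>x\<close> alone.\<close>
    have bd: "onorm (?D y) \<le> ?C * norm x ^ Suc m" if y: "y \<in> cball 0 (norm x)" for y
    proof (rule onorm_le)
      fix v
      have yx: "norm y \<le> norm x" and y\<delta>: "dist y 0 < \<delta>" using x y by (auto simp: dist_norm)
      have lin: "linear (?D y)"
        using h(1)[OF y\<delta>] smooth_at_differentiable linear_frechet_derivative by blast
      have "norm (?D y v) \<le> (\<Sum>i\<in>UNIV. norm (v $ i *\<^sub>R ?D y (axis i 1)))"
        by (subst linear_eq_sum_axis[OF lin]) (rule norm_sum)
      also have "\<dots> \<le> (\<Sum>i\<in>UNIV. norm v * (C i * norm x ^ Suc m))"
      proof (rule sum_mono)
        fix i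
        have "norm (?D y (axis i 1)) \<le> C i * norm y ^ Suc m" by (rule h(2)[OF y\<delta>])
        also have "\<dots> \<le> C i * norm x ^ Suc m"
          by (intro mult_left_mono power_mono yx C(1)) simp
        finally show "norm (v $ i *\<^sub>R ?D y (axis i 1)) \<le> norm v * (C i * norm x ^ Suc m)"
          unfolding norm_scaleR using component_le_norm_cart[of v i]
          by (intro mult_mono) simp_all
      qed
      also have "\<dots> = ?C * norm x ^ Suc m * norm v"
        by (simp add: sum_distrib_left sum_distrib_right mult_ac)
      finally show "norm (?D y v) \<le> ?C * norm x ^ Suc m * norm v" .
    qed
    have deriv: "(h has_derivative ?D y) (at y within cball 0 (norm x))" if "y \<in> cball 0 (norm x)" for y
      by (rule has_derivative_at_withinI[OF smooth_at_has_derivative[OF h(1)]])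
        (use that x in \<open>auto simp: dist_norm\<close>)
    have "norm (h x - h 0) \<le> ?C * norm x ^ Suc m * norm (x - 0)"
      by (rule differentiable_bound[OF convex_cball deriv bd]) simp_all
    then show ?thesis using Suc.prems(2)[of "[]"] by (simp add: mult_ac)
  qed
  moreover have "?C \<ge> 0" using C(1) by (simp add: sum_nonneg)
  ultimately show ?case using \<delta> unfolding eventually_nhds_metric by blast
qed

section \<open>Jets of rescaled and of linear maps\<close>

text \<open>With \<open>c = 1 / t\<close> an order-s derivative at 0 acquires the factor t^(s-1),
  which stays bounded as t tends to 0 for s at least 1.\<close>

lemma pderivs_rescale:
  assumes "smooth_at f 0"
  shows "\<forall>\<^sub>F x in nhds 0. pderivs is (\<lambda>x. c *\<^sub>R f (t *\<^sub>R x)) x = (c * t ^ length is) *\<^sub>R pderivs is f (t *\<^sub>R x)"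
proof (induction "is")
  case (Cons i "is")
  let ?g = "\<lambda>x. (c * t ^ length is) *\<^sub>R pderivs is f (t *\<^sub>R x)"
  have ev: "\<forall>\<^sub>F x in nhds 0. \<forall>\<^sub>F y in nhds x. pderivs is (\<lambda>x. c *\<^sub>R f (t *\<^sub>R x)) y = ?g y"
    using Cons by (simp add: eventually_eventually)
  have "((\<lambda>x. t *\<^sub>R x) \<longlongrightarrow> t *\<^sub>R 0) (nhds (0 :: real^'a))"
    by (intro tendsto_intros filterlim_ident)
  then have "\<forall>\<^sub>F x in nhds 0. smooth_at (pderivs is f) (t *\<^sub>R x)"
    using eventually_smooth_at[OF smooth_at_pderivs[OF assms, of "is"]]
    by (auto simp: filterlim_iff)
  then show ?case using ev
  proof eventually_elim
    case (elim x)
    let ?D = "frechet_derivative (pderivs is f) (at (t *\<^sub>R x))"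
    have "((\<lambda>x. t *\<^sub>R x) has_derivative (\<lambda>v. t *\<^sub>R v)) (at x)"
      by (auto intro!: derivative_eq_intros)
    from has_derivative_compose[OF this smooth_at_has_derivative[OF elim(1)]]
    have "(?g has_derivative (\<lambda>v. (c * t ^ length is) *\<^sub>R ?D (t *\<^sub>R v))) (at x)"
      by (rule has_derivative_scaleR_right)
    then have "frechet_derivative ?g (at x) = (\<lambda>v. (c * t ^ length is) *\<^sub>R ?D (t *\<^sub>R v))"
      by (rule frechet_derivative_at[symmetric])
    moreover have "?D (t *\<^sub>R v) = t *\<^sub>R ?D v" for v
      by (intro linear_scale linear_frechet_derivative smooth_at_differentiable elim)
    ultimately show ?case
      using frechet_derivative_cong[OF elim(2)] by (simp add: mult_ac)
  qed
qed simp

lemma pderivs_const: "is \<noteq> [] \<Longrightarrow> pderivs is (\<lambda>x. c) = (\<lambda>x. 0)"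
proof (induction "is")
  case (Cons i "is")
  then show ?case by (cases "is = []") simp_all
qed simp

lemma pderivs_linear:
  fixes A :: "real^'m^'n::finite"
  shows "pderivs is (\<lambda>x. A *v x) 0 = (if length is = 1 then A *v axis (hd is) 1 else 0)"
proof (cases "is" rule: rev_cases)
  case (snoc js i)
  have "frechet_derivative (\<lambda>x. A *v x) (at x) = (\<lambda>x. A *v x)" for x
    by (rule frechet_derivative_at[symmetric])
      (intro bounded_linear_imp_has_derivative matrix_vector_mul_bounded_linear)
  then have "pderivs is (\<lambda>x. A *v x) = pderivs js (\<lambda>x. A *v axis i 1)"
    by (simp add: snoc pderivs_append)
  then show ?thesis using snoc by (cases "js = []") (simp_all add: pderivs_const)
qed simp

section \<open>Matrices of positive determinant\<close>

definition diag_mat :: "('n \<Rightarrow> real) \<Rightarrow> real^'n^'n::finite" where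
  "diag_mat d = (\<chi> i j. if i = j then d i else 0)"

lemma diag_mat_mult_vec: "diag_mat d *v x = (\<chi> i. d i * x $ i)"
  by (simp add: vec_eq_iff matrix_vector_mult_def diag_mat_def if_distrib[of "\<lambda>y. y * _"] cong: if_cong)

lemma diag_mat_mult: "diag_mat d ** diag_mat e = diag_mat (\<lambda>i. d i * e i)"
  by (subst matrix_eq) (simp add: matrix_vector_mul_assoc[symmetric] diag_mat_mult_vec vec_eq_iff)

lemma diag_mat_one: "diag_mat (\<lambda>i. 1) = mat 1"
  by (simp add: diag_mat_def mat_def)

lemma det_diag_mat: "det (diag_mat d) = prod d UNIV"
  by (subst det_diagonal) (simp_all add: diag_mat_def)

text \<open>Written in the shape in which \<open>induct_matrix_elementary\<close> presents its row
  operations.\<close>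

definition shear :: "'n \<Rightarrow> 'n \<Rightarrow> real \<Rightarrow> real^'n^'n::finite" where
  "shear m n c = (\<chi> i j. if i = m \<and> j = n then c else of_bool (i = j))"

lemma shear_mult_vec:
  assumes "m \<noteq> n"
  shows "shear m n c *v x = (\<chi> i. if i = m then x $ m + c * x $ n else x $ i)"
proof -
  have "(\<Sum>j\<in>UNIV. (if i = m \<and> j = n then c else of_bool (i = j)) * x $ j)
      = (\<Sum>j\<in>UNIV. (if j = n then (if i = m then c * x $ n else 0) else 0) + (if j = i then x $ i else 0))" for i
    using assms by (intro sum.cong) auto
  then show ?thesis
    by (auto simp: vec_eq_iff matrix_vector_mult_def shear_def sum.distrib)
qed

lemma det_shear: "m \<noteq> n \<Longrightarrow> det (shear m n c) \<noteq> 0"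
proof -
  assume "m \<noteq> n"
  then have "shear m n c ** shear m n (- c) = mat 1"
    by (subst matrix_eq) (simp add: matrix_vector_mul_assoc[symmetric] shear_mult_vec vec_eq_iff)
  then have "det (shear m n c) * det (shear m n (- c)) = 1" by (metis det_mul det_I)
  then show ?thesis by auto
qed

section \<open>Continuity and paths in matrix space\<close>

lemma continuous_on_matrix_mult [continuous_intros]:
  fixes f :: "'a::topological_space \<Rightarrow> real^'n^'m" and g :: "'a \<Rightarrow> real^'p^'n"
  assumes "continuous_on S f" "continuous_on S g"
  shows "continuous_on S (\<lambda>x. f x ** g x)"
  unfolding matrix_matrix_mult_def using assms by (intro continuous_intros)

lemma continuous_on_matrixI:
  fixes f :: "'a::topological_space \<Rightarrow> real^'n^'m"
  assumes "\<And>i j. continuous_on S (\<lambda>x. f x $ i $ j)"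
  shows "continuous_on S f"
proof -
  have "continuous_on S (\<lambda>x. \<chi> i j. f x $ i $ j)" by (intro continuous_on_vec_lambda assms)
  then show ?thesis by simp
qed

lemma path_component_image:
  assumes "path_component S x y" "continuous_on S f" "f ` S \<subseteq> T"
  shows "path_component T (f x) (f y)"
proof -
  obtain g where g: "path g" "path_image g \<subseteq> S" "pathstart g = x" "pathfinish g = y"
    using assms(1) unfolding path_component_def by blast
  have "path (f \<circ> g)"
    using path_continuous_image[OF g(1)] continuous_on_subset[OF assms(2) g(2)] by blast
  moreover have "path_image (f \<circ> g) \<subseteq> T"
    using g(2) assms(3) by (auto simp: path_image_compose)
  ultimately show ?thesis
    unfolding path_component_def using g(3,4) by (metis pathstart_compose pathfinish_compose)
qed

lemma path_component_connected:
  assumes "path_component S x y"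
  obtains C where "connected C" "C \<subseteq> S" "x \<in> C" "y \<in> C"
  using assms unfolding path_component_def
  by (metis connected_path_image pathstart_in_path_image pathfinish_in_path_image)

text \<open>The intermediate value theorem. It is applied to \<open>det\<close> on the nonsingular
  matrices and to the Jacobian determinant read off a jet on \<open>Diff_jets\<close>.\<close>

lemma path_component_sign:
  fixes \<phi> :: "'a::topological_space \<Rightarrow> real"
  assumes "path_component S x y" "continuous_on S \<phi>" "\<And>z. z \<in> S \<Longrightarrow> \<phi> z \<noteq> 0" "\<phi> x > 0"
  shows "\<phi> y > 0"
proof (rule ccontr)
  assume "\<not> \<phi> y > 0"
  have "path_component (\<phi> ` S) (\<phi> x) (\<phi> y)"
    by (rule path_component_image[OF assms(1,2)]) simp
  then obtain C where C: "connected C" "C \<subseteq> \<phi> ` S" "\<phi> x \<in> C" "\<phi> y \<in> C"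
    by (rule path_component_connected)
  have "0 \<in> C"
    using connectedD_interval[OF C(1) C(4,3), of 0] \<open>\<not> \<phi> y > 0\<close> assms(4) by simp
  then show False using C(2) assms(3) by force
qed

section \<open>The identity component of the nonsingular matrices\<close>

abbreviation nonsingular :: "(real^'n^'n::finite) set" where
  "nonsingular \<equiv> {A. det A \<noteq> 0}"

text \<open>Defined by paths rather than by \<open>det A > 0\<close>, so that membership of products
  and generators can be shown by exhibiting paths; \<open>path_component_det_pos\<close> makes the
  connection with the determinant.\<close>

definition GL_plus :: "(real^'n^'n::finite) set" where
  "GL_plus = {A. path_component nonsingular (mat 1) A}"

lemma GL_plus_nonsingular: "A \<in> GL_plus \<Longrightarrow> det A \<noteq> 0"
  using path_component_mem(2) by (force simp: GL_plus_def)

lemma GL_plus_one: "mat 1 \<in> GL_plus"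
  by (simp add: GL_plus_def path_component_refl)

text \<open>Translating a path from the identity to \<open>A\<close> by \<open>B\<close> joins
  \<open>B\<close> to \<open>A ** B\<close>; a path from the identity to \<open>B\<close> precedes
  it.\<close>

lemma GL_plus_mult:
  assumes "A \<in> GL_plus" "B \<in> GL_plus"
  shows "A ** B \<in> GL_plus"
proof -
  have "path_component nonsingular (mat 1 ** B) (A ** B)"
    using assms(1) GL_plus_nonsingular[OF assms(2)] unfolding GL_plus_def
    by (intro path_component_image[where S=nonsingular and f="\<lambda>M. M ** B"] continuous_intros)
      (auto simp: det_mul)
  then show ?thesis using assms(2) path_component_trans unfolding GL_plus_def by fastforce
qed

lemma GL_plus_conjugate:
  assumes "A \<in> GL_plus" "R ** R = mat 1"
  shows "R ** A ** R \<in> GL_plus"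
proof -
  have "det R * det R = 1" using assms(2) by (metis det_mul det_I)
  then have "det R \<noteq> 0" by auto
  then have "path_component nonsingular (R ** mat 1 ** R) (R ** A ** R)"
    using assms(1) unfolding GL_plus_def
    by (intro path_component_image[where S=nonsingular and f="\<lambda>M. R ** M ** R"] continuous_intros)
      (auto simp: det_mul)
  then show ?thesis by (simp add: GL_plus_def assms(2))
qed

lemma GL_plus_curve:
  fixes g :: "real \<Rightarrow> real^'n^'n"
  assumes "continuous_on {0..1} g" "\<And>t. t \<in> {0..1} \<Longrightarrow> det (g t) \<noteq> 0" "g 0 = mat 1"
  shows "g 1 \<in> GL_plus"
  unfolding GL_plus_def path_component_def mem_Collect_eq
  by (rule exI[of _ g]) (use assms in \<open>auto simp: path_def path_image_def pathstart_def pathfinish_def\<close>)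

lemma shear_GL_plus:
  assumes "m \<noteq> n"
  shows "shear m n c \<in> GL_plus"
proof -
  have "continuous_on {0..1} (\<lambda>t. shear m n (t * c))"
  proof (rule continuous_on_matrixI)
    show "continuous_on {0..1} (\<lambda>t. shear m n (t * c) $ i $ j)" for i j
      by (cases "i = m"; cases "j = n") (simp_all add: shear_def continuous_on_mult_right)
  qed
  moreover have "shear m n (0 * c) = mat 1"
    using assms by (auto simp: shear_def mat_def vec_eq_iff)
  ultimately show ?thesis
    using GL_plus_curve[of "\<lambda>t. shear m n (t * c)"] det_shear[OF assms] by simp
qed

text \<open>A rotation by a right angle is a product of three shears, so no path of rotations has to
  be written down.\<close>

lemma quarter_turn_GL_plus:
  assumes "m \<noteq> n"
  obtains W where "W \<in> GL_plus"
    "\<And>x. W *v x = (\<chi> i. if i = m then x $ n else if i = n then - x $ m else x $ i)"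
proof
  let ?W = "shear m n 1 ** (shear n m (-1) ** shear m n 1)"
  show "?W \<in> GL_plus" using assms by (intro GL_plus_mult shear_GL_plus) auto
  show "?W *v x = (\<chi> i. if i = m then x $ n else if i = n then - x $ m else x $ i)" for x
    using assms by (simp add: matrix_vector_mul_assoc[symmetric] shear_mult_vec vec_eq_iff)
qed

abbreviation reflection :: "'n \<Rightarrow> real^'n^'n::finite" where
  "reflection a \<equiv> diag_mat ((\<lambda>_. 1)(a := -1))"

lemma reflection_involution: "reflection a ** reflection a = mat 1"
  by (simp add: diag_mat_mult diag_mat_one[symmetric]) (rule arg_cong[where f=diag_mat], auto)

text \<open>The property \<open>?Q\<close> says that \<open>A\<close> lies in one of two cosets of
  the identity component. It is closed under products, so checking it on elementary matrices
  suffices; a matrix with a zero row is excluded by its determinant.\<close>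

lemma GL_plus_or_reflection:
  fixes A :: "real^'n^'n::finite"
  assumes "det A \<noteq> 0"
  shows "A \<in> GL_plus \<or> A ** reflection a \<in> GL_plus"
proof -
  let ?R = "reflection a :: real^'n^'n"
  let ?Q = "\<lambda>A::real^'n^'n. A \<in> GL_plus \<or> A ** ?R \<in> GL_plus"
  \<comment> \<open>If \<open>A\<close> needs the reflection, \<open>A ** ?R\<close> is multiplied
    by a conjugate by \<open>?R\<close> of whichever of \<open>B\<close>, \<open>B ** ?R\<close>
    lies in \<open>GL_plus\<close>. The adjacent reflections cancel, and
    \<open>GL_plus_conjugate\<close> keeps the second factor in the component.\<close>
  have mult: "?Q (A ** B)" if Q: "?Q A" "?Q B" for A B
  proof -
    have R: "M ** ?R ** ?R = M" for M :: "real^'n^'n"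
      by (simp add: matrix_mul_assoc[symmetric] reflection_involution)
    consider "A \<in> GL_plus" "B \<in> GL_plus" | "A \<in> GL_plus" "B ** ?R \<in> GL_plus"
      | "A ** ?R \<in> GL_plus" "B \<in> GL_plus" | "A ** ?R \<in> GL_plus" "B ** ?R \<in> GL_plus"
      using Q by blast
    then show ?thesis
    proof cases
      case 1
      then show ?thesis by (simp add: GL_plus_mult)
    next
      case 2
      then show ?thesis using GL_plus_mult[OF 2] by (simp add: matrix_mul_assoc)
    next
      case 3
      have "A ** ?R ** (?R ** B ** ?R) = A ** B ** ?R" by (simp add: matrix_mul_assoc R)
      then show ?thesis
        using GL_plus_mult[OF 3(1) GL_plus_conjugate[OF 3(2) reflection_involution[of a]]] by simp
    next
      case 4
      have "A ** ?R ** (?R ** (B ** ?R) ** ?R) = A ** B" by (simp add: matrix_mul_assoc R)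
      then show ?thesis
        using GL_plus_mult[OF 4(1) GL_plus_conjugate[OF 4(2) reflection_involution[of a]]] by simp
    qed
  qed
  have refl: "?Q (reflection i)" for i
  proof (cases "i = a")
    case True
    then show ?thesis by (simp add: reflection_involution GL_plus_one)
  next
    case False
    then obtain W where W: "W \<in> GL_plus"
      "\<And>x. W *v x = (\<chi> k. if k = i then x $ a else if k = a then - x $ i else x $ k)"
      using quarter_turn_GL_plus by metis
    \<comment> \<open>Two reflections make the half turn in the plane of coordinates
      \<open>i\<close> and \<open>a\<close>, the square of the quarter turn.\<close>
    have "reflection i ** ?R = W ** W"
      using False by (subst matrix_eq)
        (simp add: matrix_vector_mul_assoc[symmetric] diag_mat_mult_vec W(2) vec_eq_iff)
    then show ?thesis using GL_plus_mult[OF W(1) W(1)] by simp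
  qed
  have pos: "?Q (diag_mat ((\<lambda>_. 1)(i := c)))" if "c > 0" for i c
  proof -
    let ?g = "\<lambda>t. diag_mat ((\<lambda>_. 1)(i := 1 - t + t * c)) :: real^'n^'n"
    have nz: "1 - t + t * c \<noteq> 0" if "t \<in> {0..1}" for t
    proof (cases "t = 1")
      case False
      then have "1 - t > 0" "t * c \<ge> 0" using that \<open>c > 0\<close> by auto
      then show ?thesis by linarith
    qed (use \<open>c > 0\<close> in simp)
    have "?g 1 \<in> GL_plus"
    proof (rule GL_plus_curve[of ?g])
      show "continuous_on {0..1} ?g"
      proof (rule continuous_on_matrixI)
        show "continuous_on {0..1} (\<lambda>t. ?g t $ k $ j)" for k j
          by (cases "k = j"; cases "k = i") (simp_all add: diag_mat_def continuous_on_add continuous_on_diff continuous_on_mult_right)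
      qed
      show "det (?g t) \<noteq> 0" if "t \<in> {0..1}" for t
        using nz[OF that] by (simp add: det_diag_mat)
      show "?g 0 = mat 1" by (simp add: diag_mat_one[symmetric]) (rule arg_cong[where f=diag_mat], auto)
    qed
    then show ?thesis by simp
  qed
  have single: "?Q (diag_mat ((\<lambda>_. 1)(i := c)))" if "c \<noteq> 0" for i c
  proof (cases "c > 0")
    case False
    then have "?Q (diag_mat ((\<lambda>_. 1)(i := - c)) ** reflection i)"
      using that by (intro mult pos refl) auto
    moreover have "(diag_mat ((\<lambda>_. 1)(i := - c)) ** reflection i :: real^'n^'n) = diag_mat ((\<lambda>_. 1)(i := c))"
      unfolding diag_mat_mult by (rule arg_cong[where f=diag_mat]) auto
    ultimately show ?thesis by simp
  qed (rule pos)
  have diag: "?Q (diag_mat d)" if "finite S" "\<And>i. d i \<noteq> 0" "\<And>i. i \<notin> S \<Longrightarrow> d i = 1" for S d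
    using that
  proof (induction S arbitrary: d rule: finite_induct)
    case empty
    then have "d = (\<lambda>i. 1)" by auto
    then show ?case by (simp add: diag_mat_one GL_plus_one)
  next
    case (insert i S)
    have eq: "diag_mat d = diag_mat (d(i := 1)) ** (diag_mat ((\<lambda>_. 1)(i := d i)) :: real^'n^'n)"
      unfolding diag_mat_mult by (rule arg_cong[where f=diag_mat]) auto
    have "?Q (diag_mat (d(i := 1)))" using insert.prems by (intro insert.IH) auto
    then show ?case unfolding eq by (rule mult[OF _ single]) (rule insert.prems(1))
  qed
  have "det A \<noteq> 0 \<longrightarrow> ?Q A"
  proof (induction A rule: induct_matrix_elementary)
    case (1 A B)
    show ?case
    proof
      assume "det (A ** B) \<noteq> 0"
      then have "det A \<noteq> 0" "det B \<noteq> 0" by (simp_all add: det_mul)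
      then show "?Q (A ** B)" using 1 by (intro mult) blast+
    qed
  next
    case (2 A i)
    then show ?case using det_zero_row(2) by blast
  next
    case (3 A)
    then have "A = diag_mat (\<lambda>i. A $ i $ i)" by (simp add: diag_mat_def vec_eq_iff)
    then obtain d where d: "A = diag_mat d" ..
    show ?case
    proof
      assume "det A \<noteq> 0"
      then have "d i \<noteq> 0" for i by (simp add: d det_diag_mat)
      then show "?Q A" unfolding d by (intro diag[of UNIV]) auto
    qed
  next
    case (4 m n)
    then obtain W where W: "W \<in> GL_plus"
      "\<And>x. W *v x = (\<chi> k. if k = m then x $ n else if k = n then - x $ m else x $ k)"
      using quarter_turn_GL_plus by metis
    have swap: "i = Transposition.transpose m n j \<longleftrightarrow> Transposition.transpose m n i = j" for i j
      by (metis transpose_involutory)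
    \<comment> \<open>The quarter turn exchanges the two coordinates up to a sign in coordinate
      \<open>n\<close>, which the reflection removes.\<close>
    have eq: "(\<chi> i j. mat 1 $ i $ Transposition.transpose m n j) = reflection n ** W"
      (is "?S = _")
    proof (subst matrix_eq, rule allI)
      fix x
      have "?S *v x = (\<chi> i. x $ Transposition.transpose m n i)"
        by (simp add: vec_eq_iff matrix_vector_mult_def mat_def if_distrib[of "\<lambda>y. y * _"]
            swap cong: if_cong)
      then show "?S *v x = (reflection n ** W) *v x"
        using 4 by (simp add: matrix_vector_mul_assoc[symmetric] diag_mat_mult_vec W(2) vec_eq_iff transpose_def)
    qed
    have "?Q ?S" unfolding eq by (rule mult[OF refl]) (simp add: W(1))
    then show ?case ..
  next
    case (5 m n c)
    then show ?case using shear_GL_plus[of m n c] by (simp add: shear_def)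
  qed
  then show ?thesis using assms by blast
qed

lemma continuous_on_det: "continuous_on S (det :: real^'n^'n \<Rightarrow> real)"
  unfolding det_def by (intro continuous_intros)

text \<open>The only alternative left by \<open>GL_plus_or_reflection\<close> is that
  \<open>A\<close> times a reflection lies in the identity component. That product has negative
  determinant, while the determinant stays positive along a path of nonsingular matrices from the
  identity.\<close>

lemma path_component_det_pos:
  fixes A :: "real^'n^'n::finite"
  assumes "det A > 0"
  shows "path_component nonsingular (mat 1) A"
proof -
  have pos: "det B > 0" if "B \<in> GL_plus" for B :: "real^'n^'n"
    by (rule path_component_sign[of nonsingular "mat 1" B det])
      (use that in \<open>simp_all add: GL_plus_def continuous_on_det\<close>)
  have "det (reflection i :: real^'n^'n) = -1" for i
    by (simp add: det_diag_mat fun_upd_def)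
  then have "A ** reflection i \<notin> GL_plus" for i
    using pos[of "A ** reflection i"] assms by (fastforce simp only: det_mul)
  then have "A \<in> GL_plus" using GL_plus_or_reflection[of A] assms by fastforce
  then show ?thesis by (simp add: GL_plus_def)
qed

section \<open>Diffeomorphism germs\<close>

lemma jacobian_entry: "jacobian f (at p) $ i $ j = frechet_derivative f (at p) (axis j 1) $ i"
  by (simp add: jacobian_def matrix_def)

lemma has_derivative_jacobian:
  "f differentiable (at p) \<Longrightarrow> (f has_derivative (\<lambda>v. jacobian f (at p) *v v)) (at p)"
  for f :: "real^'m \<Rightarrow> real^'n"
  by (simp add: jacobian_works)

lemma jacobian_mult_vec:
  "f differentiable (at p) \<Longrightarrow> jacobian f (at p) *v v = frechet_derivative f (at p) v"
  for f :: "real^'m \<Rightarrow> real^'n"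
  using frechet_derivative_at[OF has_derivative_jacobian] by metis

lemma jacobian_eqI:
  fixes f :: "real^'m \<Rightarrow> real^'n"
  assumes "(f has_derivative (\<lambda>v. A *v v)) (at p)"
  shows "jacobian f (at p) = A"
  by (simp add: jacobian_def frechet_derivative_at[OF assms, symmetric])

lemma jacobian_det_compose:
  fixes f g :: "real^'n \<Rightarrow> real^'n"
  assumes "g differentiable (at p)" "f differentiable (at (g p))"
  shows "jacobian_det (\<lambda>x. f (g x)) p = jacobian_det f (g p) * jacobian_det g p"
proof -
  have "((\<lambda>x. f (g x)) has_derivative (\<lambda>v. (jacobian f (at (g p)) ** jacobian g (at p)) *v v)) (at p)"
    using has_derivative_compose[OF has_derivative_jacobian[OF assms(1)] has_derivative_jacobian[OF assms(2)]]
    by (simp add: matrix_vector_mul_assoc)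
  then show ?thesis by (simp add: jacobian_det_def jacobian_eqI det_mul)
qed

lemma jacobian_det_cong:
  "\<forall>\<^sub>F x in nhds p. f x = g x \<Longrightarrow> jacobian_det f p = jacobian_det g p"
  by (simp add: jacobian_det_def jacobian_def frechet_derivative_cong)

lemma jacobian_det_linear: "jacobian_det (\<lambda>x. A *v x) p = det A"
proof -
  have "jacobian (\<lambda>x. A *v x) (at p) = A"
    by (intro jacobian_eqI bounded_linear_imp_has_derivative matrix_vector_mul_bounded_linear)
  then show ?thesis by (simp add: jacobian_det_def)
qed

lemma smooth_germ_tendsto: "smooth_germ f \<Longrightarrow> filterlim f (nhds 0) (nhds 0)"
  using smooth_at_continuous[of f 0] tendsto_at_iff_tendsto_nhds[of f 0]
  by (simp add: smooth_germ_iff isCont_def)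

lemma eventually_smooth_germ:
  "smooth_germ f \<Longrightarrow> \<forall>\<^sub>F x in nhds 0. P x \<Longrightarrow> \<forall>\<^sub>F x in nhds 0. P (f x)"
  using smooth_germ_tendsto by (rule eventually_compose_filterlim[rotated])

lemma smooth_germ_compose: "smooth_germ f \<Longrightarrow> smooth_germ g \<Longrightarrow> smooth_germ (\<lambda>x. f (g x))"
  by (simp add: smooth_germ_iff smooth_at_compose)

lemma smooth_germ_linear:
  "bounded_linear f \<Longrightarrow> smooth_germ (f :: real^'m::finite \<Rightarrow> real^'n::finite)"
  by (simp add: smooth_germ_iff smooth_at_linear linear_0 bounded_linear.linear)

lemma diffeo_germ_smooth: "diffeo_germ \<sigma> \<Longrightarrow> smooth_germ \<sigma>"
  by (simp add: diffeo_germ_def)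

lemma diffeo_germ_differentiable: "diffeo_germ \<sigma> \<Longrightarrow> \<sigma> differentiable (at 0)"
  by (simp add: diffeo_germ_def smooth_germ_iff smooth_at_differentiable)

lemma diffeo_germ_zero: "diffeo_germ \<sigma> \<Longrightarrow> \<sigma> 0 = 0"
  by (simp add: diffeo_germ_def smooth_germ_iff)

lemma diffeo_germ_inverse:
  assumes "diffeo_germ \<sigma>"
  obtains \<rho> where "diffeo_germ \<rho>" "\<forall>\<^sub>F x in nhds 0. \<rho> (\<sigma> x) = x" "\<forall>\<^sub>F x in nhds 0. \<sigma> (\<rho> x) = x"
  using assms unfolding diffeo_germ_def by blast

lemma diffeo_germ_compose:
  assumes "diffeo_germ \<sigma>" "diffeo_germ \<tau>"
  shows "diffeo_germ (\<lambda>x. \<sigma> (\<tau> x))"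
proof -
  obtain \<sigma>' where s: "diffeo_germ \<sigma>'" "\<forall>\<^sub>F x in nhds 0. \<sigma>' (\<sigma> x) = x" "\<forall>\<^sub>F x in nhds 0. \<sigma> (\<sigma>' x) = x"
    by (rule diffeo_germ_inverse[OF assms(1)])
  obtain \<tau>' where t: "diffeo_germ \<tau>'" "\<forall>\<^sub>F x in nhds 0. \<tau>' (\<tau> x) = x" "\<forall>\<^sub>F x in nhds 0. \<tau> (\<tau>' x) = x"
    by (rule diffeo_germ_inverse[OF assms(2)])
  note sm = assms[THEN diffeo_germ_smooth] s(1)[THEN diffeo_germ_smooth] t(1)[THEN diffeo_germ_smooth]
  have "\<forall>\<^sub>F x in nhds 0. \<tau>' (\<sigma>' (\<sigma> (\<tau> x))) = x"
    using eventually_smooth_germ[OF sm(2) s(2)] t(2) by eventually_elim simp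
  moreover have "\<forall>\<^sub>F x in nhds 0. \<sigma> (\<tau> (\<tau>' (\<sigma>' x))) = x"
    using eventually_smooth_germ[OF sm(3) t(3)] s(3) by eventually_elim simp
  moreover have "smooth_germ (\<lambda>x. \<tau>' (\<sigma>' x))" "smooth_germ (\<lambda>x. \<sigma> (\<tau> x))"
    using sm by (auto intro: smooth_germ_compose)
  ultimately show ?thesis unfolding diffeo_germ_def by blast
qed

lemma diffeo_germ_linear:
  fixes A :: "real^'n^'n::finite"
  assumes "det A \<noteq> 0"
  shows "diffeo_germ (\<lambda>x. A *v x)"
proof -
  obtain B where B: "A ** B = mat 1" "B ** A = mat 1"
    using assms invertible_det_nz[of A] unfolding invertible_def by blast
  have "smooth_germ (\<lambda>x. M *v x)" for M :: "real^'n^'n"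
    by (intro smooth_germ_linear matrix_vector_mul_bounded_linear)
  moreover have "B *v (A *v x) = x" "A *v (B *v x) = x" for x
    by (simp_all add: matrix_vector_mul_assoc B)
  ultimately show ?thesis unfolding diffeo_germ_def
    by (intro conjI exI[of _ "\<lambda>x. B *v x"]) simp_all
qed

lemma diffeo_germ_scaleR:
  assumes "c \<noteq> 0"
  shows "diffeo_germ (\<lambda>x::real^'n::finite. c *\<^sub>R x)"
  unfolding diffeo_germ_def using assms
  by (intro conjI exI[of _ "\<lambda>x. inverse c *\<^sub>R x"] smooth_germ_linear bounded_linear_scaleR_right) simp_all

lemma diffeo_germ_jacobian_det:
  fixes \<sigma> :: "real^'n::finite \<Rightarrow> real^'n"
  assumes "diffeo_germ \<sigma>"
  shows "jacobian_det \<sigma> 0 \<noteq> 0"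
proof -
  obtain \<rho> where r: "diffeo_germ \<rho>" "\<forall>\<^sub>F x in nhds 0. \<rho> (\<sigma> x) = x"
    using diffeo_germ_inverse[OF assms] by blast
  have "jacobian_det (\<lambda>x. \<rho> (\<sigma> x)) 0 = jacobian_det (\<lambda>x::real^'n. mat 1 *v x) 0"
    by (rule jacobian_det_cong) (use r(2) in simp)
  then show ?thesis
    using assms r(1) diffeo_germ_zero[OF assms]
    by (subst (asm) jacobian_det_compose) (auto simp: jacobian_det_linear diffeo_germ_differentiable)
qed

section \<open>Isotopies of jets\<close>

lemma rescaling_path:
  assumes "diffeo_germ S"
  shows "path_component (Diff_jets r) (jet r (\<lambda>x. jacobian S (at 0) *v x)) (jet r S)"
proof -
  \<comment> \<open>These are the derivatives at 0 of S(tx)/t, written without division. They are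
    polynomial in \<open>t\<close>, hence continuous through \<open>t = 0\<close>, where
    \<open>0 ^ 0 = 1\<close> leaves exactly the linear part of \<open>S\<close>.\<close>
  define g where "g = (\<lambda>(t::real) is. if length is \<le> r then
    (if length is = 0 then 0 else t ^ (length is - 1) *\<^sub>R pderivs is S 0) else 0)"
  have S: "smooth_at S 0" "S 0 = 0" using assms by (simp_all add: diffeo_germ_def smooth_germ_iff)
  let ?A = "jacobian S (at 0)"
  have A: "?A *v axis i 1 = pderivs [i] S 0" for i
    by (simp add: jacobian_mult_vec smooth_at_differentiable S)
  have g0: "g 0 = jet r (\<lambda>x. ?A *v x)"
  proof
    fix "is"
    show "g 0 is = jet r (\<lambda>x. ?A *v x) is"
    proof (cases "length is = 1")
      case True
      then obtain i where "is = [i]" by (auto simp: length_Suc_conv)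
      then show ?thesis using A by (simp add: g_def jet_def pderivs_linear del: pderivs.simps)
    next
      case False
      then consider "length is = 0" | "length is > 1" by linarith
      then show ?thesis by cases (auto simp: g_def jet_def pderivs_linear)
    qed
  qed
  have gt: "g t = jet r (\<lambda>x. (1 / t) *\<^sub>R S (t *\<^sub>R x))" if "t \<noteq> 0" for t
  proof
    fix "is"
    have "pderivs is (\<lambda>x. (1 / t) *\<^sub>R S (t *\<^sub>R x)) 0 = (1 / t * t ^ length is) *\<^sub>R pderivs is S 0"
      using eventually_nhds_x_imp_x[OF pderivs_rescale[OF S(1), of "is" "1 / t" t]] by simp
    then show "g t is = jet r (\<lambda>x. (1 / t) *\<^sub>R S (t *\<^sub>R x)) is"
      using that S(2) by (cases "is") (simp_all add: g_def jet_def del: pderivs.simps(2))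
  qed
  have "path g"
    unfolding path_def
  proof (rule continuous_on_coordinatewise_then_product)
    fix "is"
    show "continuous_on {0..1} (\<lambda>t. g t is)"
      by (cases "length is \<le> r \<and> length is \<noteq> 0") (auto simp: g_def intro!: continuous_intros)
  qed
  moreover have "g t \<in> Diff_jets r" for t
  proof (cases "t = 0")
    case True
    have "det ?A \<noteq> 0" using diffeo_germ_jacobian_det[OF assms] by (simp add: jacobian_det_def)
    then show ?thesis
      unfolding True g0 Diff_jets_def by (intro imageI CollectI diffeo_germ_linear)
  next
    case False
    have "diffeo_germ (\<lambda>x. (1 / t) *\<^sub>R S (t *\<^sub>R x))"
      using False by (intro diffeo_germ_compose[OF diffeo_germ_scaleR diffeo_germ_compose[OF assms diffeo_germ_scaleR]]) simp_all
    then show ?thesis unfolding gt[OF False] Diff_jets_def by blast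
  qed
  then have "path_image g \<subseteq> Diff_jets r" by (auto simp: path_image_def)
  moreover have "pathstart g = jet r (\<lambda>x. ?A *v x)" "pathfinish g = jet r S"
    using gt[of 1] by (simp_all add: pathstart_def pathfinish_def g0)
  ultimately show ?thesis unfolding path_component_def by blast
qed

lemma linear_jet_path:
  fixes A B :: "real^'n^'n::finite"
  assumes "path_component nonsingular A B"
  shows "path_component (Diff_jets r) (jet r (\<lambda>x. A *v x)) (jet r (\<lambda>x. B *v x))"
proof (rule path_component_image[OF assms, where f="\<lambda>M. jet r (\<lambda>x. M *v x)"])
  show "continuous_on nonsingular (\<lambda>M :: real^'n^'n. jet r (\<lambda>x. M *v x))"
  proof (rule continuous_on_coordinatewise_then_product)
    fix "is" :: "'n list"
    have eq: "jet r (\<lambda>x. M *v x) is = (if length is \<le> r \<and> length is = 1 then M *v axis (hd is) 1 else 0)"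
      for M :: "real^'n^'n"
      by (simp add: jet_def pderivs_linear)
    have cont: "continuous_on nonsingular (\<lambda>M :: real^'n^'n. M *v v)" for v
      unfolding matrix_vector_mult_def by (intro continuous_intros)
    show "continuous_on nonsingular (\<lambda>M :: real^'n^'n. jet r (\<lambda>x. M *v x) is)"
    proof (cases "length is \<le> r \<and> length is = 1")
      case True
      then show ?thesis unfolding eq using cont by (simp cong: if_cong)
    next
      case False
      then show ?thesis unfolding eq by (simp only: if_False continuous_on_const)
    qed
  qed
qed (auto simp: Diff_jets_def diffeo_germ_linear)

lemma positive_diffeo_path:
  assumes "diffeo_germ S" "jacobian_det S 0 > 0"
  shows "path_component (Diff_jets r) (jet r id) (jet r S)"
proof -
  have "jet r id = jet r (\<lambda>x. mat 1 *v x)" by (rule arg_cong[where f="jet r"]) auto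
  then show ?thesis
    using linear_jet_path[OF path_component_det_pos] rescaling_path[OF assms(1)] assms(2)
      path_component_trans unfolding jacobian_det_def by metis
qed

text \<open>For \<open>1 \<le> r\<close> the Jacobian determinant is a continuous function of the
  first-order entries of a jet and vanishes nowhere on \<open>Diff_jets r\<close>, so it keeps the
  sign it has at the identity.\<close>

lemma path_positive_diffeo:
  fixes S :: "real^'n::finite \<Rightarrow> real^'n"
  assumes "path_component (Diff_jets r) (jet r id) (jet r S)" "1 \<le> r"
  shows "jacobian_det S 0 > 0"
proof -
  define \<phi> where "\<phi> = (\<lambda>j :: 'n list \<Rightarrow> real^'n. det (\<chi> i k. j [k] $ i))"
  have \<phi>: "\<phi> (jet r \<sigma>) = jacobian_det \<sigma> 0" for \<sigma>
    using assms(2) by (simp add: \<phi>_def jet_def jacobian_det_def jacobian_def matrix_def)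
  have entry: "continuous_on (Diff_jets r) (\<lambda>j :: 'n list \<Rightarrow> real^'n. j [k])" for k
    by (rule continuous_on_product_then_coordinatewise[where f="\<lambda>j. j"]) (rule continuous_on_id)
  have "continuous_on (Diff_jets r) (\<lambda>j :: 'n list \<Rightarrow> real^'n. (\<chi> i k. j [k] $ i) :: real^'n^'n)"
    by (intro continuous_on_vec_lambda continuous_on_component entry)
  then have "continuous_on (Diff_jets r) \<phi>"
    unfolding \<phi>_def by (rule continuous_on_compose2[OF continuous_on_det[of UNIV]]) simp
  moreover have "\<phi> z \<noteq> 0" if "z \<in> Diff_jets r" for z
    using that by (auto simp: Diff_jets_def \<phi> diffeo_germ_jacobian_det)
  moreover have "\<phi> (jet r id) > 0"
    using jacobian_det_linear[of "mat 1" "0 :: real^'n"] by (simp add: \<phi> id_def)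
  ultimately have "\<phi> (jet r S) > 0" by (rule path_component_sign[OF assms(1)])
  then show ?thesis by (simp add: \<phi>)
qed

definition positive_germ :: "(real^'n::finite \<Rightarrow> real^'n) \<Rightarrow> bool" where
  "positive_germ \<sigma> \<longleftrightarrow> diffeo_germ \<sigma> \<and> jacobian_det \<sigma> 0 > 0"

text \<open>The same pair of germs serves every \<open>r\<close>, because orientation-preserving
  germs are joined to the identity in jets of any order.\<close>

lemma A_isotopicI:
  assumes "positive_germ S" "positive_germ T" "\<forall>\<^sub>F x in nhds 0. g x = T (f (S x))"
  shows "A_equivalent f g" "A_isotopic r f g"
proof -
  have eq: "\<forall>\<^sub>F x in nhds 0. g x = (T \<circ> f \<circ> S) x" using assms(3) by simp
  then show "A_equivalent f g"
    using assms(1,2) unfolding A_equivalent_def positive_germ_def by blast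
  obtain \<sigma> where s: "path \<sigma>" "path_image \<sigma> \<subseteq> Diff_jets r" "pathstart \<sigma> = jet r id" "pathfinish \<sigma> = jet r S"
    using positive_diffeo_path[of S r] assms(1) unfolding positive_germ_def path_component_def by blast
  obtain \<tau> where t: "path \<tau>" "path_image \<tau> \<subseteq> Diff_jets r" "pathstart \<tau> = jet r id" "pathfinish \<tau> = jet r T"
    using positive_diffeo_path[of T r] assms(2) unfolding positive_germ_def path_component_def by blast
  show "A_isotopic r f g"
    unfolding A_isotopic_def
    using s t assms(1,2) jet_cong[OF eq, of r]
    unfolding positive_germ_def path_def path_image_def pathstart_def pathfinish_def by metis
qed

lemma A_isotopicE:
  fixes f g :: "real^'m::finite \<Rightarrow> real^'n::finite"
  assumes "A_isotopic r f g" "1 \<le> r"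
  obtains S T where "positive_germ S" "positive_germ T" "jet r g = jet r (\<lambda>x. T (f (S x)))"
proof -
  obtain \<sigma> :: "real \<Rightarrow> 'm list \<Rightarrow> real^'m" and \<tau> :: "real \<Rightarrow> 'n list \<Rightarrow> real^'n" and S T where
    s: "continuous_on {0..1} \<sigma>" "\<sigma> ` {0..1} \<subseteq> Diff_jets r" "\<sigma> 0 = jet r id" and
    t: "continuous_on {0..1} \<tau>" "\<tau> ` {0..1} \<subseteq> Diff_jets r" "\<tau> 0 = jet r id" and
    ST: "diffeo_germ S" "diffeo_germ T" "jet r S = \<sigma> 1" "jet r T = \<tau> 1" "jet r g = jet r (T \<circ> f \<circ> S)"
    using assms(1) unfolding A_isotopic_def by (elim exE conjE) (rule that; assumption)
  have "path_component (Diff_jets r) (jet r id) (jet r S)" "path_component (Diff_jets r) (jet r id) (jet r T)"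
    unfolding path_component_def path_def path_image_def pathstart_def pathfinish_def
    using s t ST(3,4) by metis+
  then have "positive_germ S" "positive_germ T"
    using path_positive_diffeo[OF _ assms(2)] ST(1,2) by (auto simp: positive_germ_def)
  moreover have "jet r g = jet r (\<lambda>x. T (f (S x)))"
    using ST(5) by (simp add: comp_def)
  ultimately show ?thesis by (rule that)
qed

section \<open>Orders of vanishing along a curve\<close>

definition real_deriv :: "(real \<Rightarrow> real) \<Rightarrow> real \<Rightarrow> real" where
  "real_deriv p = (\<lambda>t. frechet_derivative p (at t) 1)"

lemma smooth_at_real_deriv: "smooth_at p t \<Longrightarrow> smooth_at (real_deriv p) t"
  unfolding real_deriv_def by (rule smooth_at_frechet)

lemma smooth_at_DERIV:
  assumes "smooth_at p t"
  shows "(p has_real_derivative real_deriv p t) (at t)"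
proof -
  have "linear (frechet_derivative p (at t))"
    using assms by (intro linear_frechet_derivative smooth_at_differentiable)
  from linear_scale[OF this, of _ 1] have "frechet_derivative p (at t) v = real_deriv p t * v" for v
    by (metis mult.commute mult_1_right real_deriv_def real_scaleR_def)
  then have "frechet_derivative p (at t) = (*) (real_deriv p t)" by (rule ext)
  then show ?thesis
    using smooth_at_has_derivative[OF assms] by (simp add: has_field_derivative_def)
qed

text \<open>The Taylor coefficient of order \<open>m\<close>, obtained by repeated use of
  l'Hospital's rule.\<close>

lemma quotient_limit_Taylor:
  assumes "smooth_at p 0" "\<And>i. i < m \<Longrightarrow> (real_deriv ^^ i) p 0 = 0"
  shows "((\<lambda>t. p t / t ^ m) \<longlongrightarrow> (real_deriv ^^ m) p 0 / fact m) (at 0)"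
  using assms
proof (induction m arbitrary: p)
  case 0
  then show ?case using smooth_at_continuous by (simp add: isCont_def)
next
  case (Suc m)
  have "(\<lambda>t. real_deriv p t / t ^ m) \<midarrow>0\<rightarrow> (real_deriv ^^ m) (real_deriv p) 0 / fact m"
  proof (rule Suc.IH)
    show "(real_deriv ^^ i) (real_deriv p) 0 = 0" if "i < m" for i
      using Suc.prems(2)[of "Suc i"] that by (simp add: funpow_swap1)
  qed (rule smooth_at_real_deriv[OF Suc.prems(1)])
  then have "(\<lambda>t. real_deriv p t / t ^ m / (1 + real m)) \<midarrow>0\<rightarrow>
      (real_deriv ^^ m) (real_deriv p) 0 / fact m / (1 + real m)"
    by (rule tendsto_divide) simp_all
  then have lim: "(\<lambda>t. real_deriv p t / ((1 + real m) * t ^ m)) \<midarrow>0\<rightarrow> (real_deriv ^^ Suc m) p 0 / fact (Suc m)"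
    by (simp add: funpow_swap1 mult.commute)
  show ?case
  proof (rule lhopital[OF _ _ _ _ _ _ lim])
    show "p \<midarrow>0\<rightarrow> 0"
      using smooth_at_continuous[OF Suc.prems(1)] Suc.prems(2)[of 0] by (simp add: isCont_def)
    show "(\<lambda>t::real. t ^ Suc m) \<midarrow>0\<rightarrow> 0"
      by (rule tendsto_eq_intros refl)+ simp
    have "\<forall>\<^sub>F t in at 0. smooth_at p t"
      using eventually_smooth_at[OF Suc.prems(1)] by (simp add: eventually_at_filter eventually_mono)
    then show "\<forall>\<^sub>F t in at 0. (p has_real_derivative real_deriv p t) (at t)"
      by eventually_elim (rule smooth_at_DERIV)
    show "\<forall>\<^sub>F t in at 0. ((\<lambda>t. t ^ Suc m) has_real_derivative (1 + real m) * t ^ m) (at t)"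
      using DERIV_pow[of "Suc m"] by simp
    show "\<forall>\<^sub>F t::real in at 0. t ^ Suc m \<noteq> 0"
      using eventually_neq_at_within[of 0 0 UNIV] by eventually_elim simp
    show "\<forall>\<^sub>F t::real in at 0. (1 + real m) * t ^ m \<noteq> 0"
      using eventually_neq_at_within[of 0 0 UNIV] by eventually_elim (simp add: add_nonneg_eq_0_iff)
  qed
qed

text \<open>Asymptotics cannot be differentiated in general. For smooth \<open>p\<close> they can:
  the limit forces all Taylor coefficients below order \<open>Suc m\<close> to vanish and determines
  the next one, and the derivative inherits this expansion.\<close>

lemma quotient_limit_real_deriv:
  assumes "smooth_at p 0" "((\<lambda>t. p t / t ^ Suc m) \<longlongrightarrow> c) (at 0)"
  shows "((\<lambda>t. real_deriv p t / t ^ m) \<longlongrightarrow> real (Suc m) * c) (at 0)"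
proof -
  have zero: "(real_deriv ^^ i) p 0 = 0" if "i < Suc m" for i
    using that
  proof (induction i rule: less_induct)
    case (less i)
    have "(\<lambda>t. p t / t ^ i) \<midarrow>0\<rightarrow> (real_deriv ^^ i) p 0 / fact i"
      using less by (intro quotient_limit_Taylor assms(1)) auto
    moreover have "(\<lambda>t. p t / t ^ i) \<midarrow>0\<rightarrow> 0 ^ (Suc m - i) * c"
    proof (rule Lim_transform_eventually)
      show "(\<lambda>t. t ^ (Suc m - i) * (p t / t ^ Suc m)) \<midarrow>0\<rightarrow> 0 ^ (Suc m - i) * c"
        by (intro tendsto_intros assms(2))
      show "\<forall>\<^sub>F t in at 0. t ^ (Suc m - i) * (p t / t ^ Suc m) = p t / t ^ i"
        unfolding eventually_at_filter
      proof (intro always_eventually allI impI)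
        fix t :: real assume "t \<noteq> 0"
        moreover have "t ^ Suc m = t ^ (Suc m - i) * t ^ i"
          using less.prems by (simp only: power_add[symmetric]) simp
        ultimately show "t ^ (Suc m - i) * (p t / t ^ Suc m) = p t / t ^ i" by simp
      qed
    qed
    ultimately have "(real_deriv ^^ i) p 0 / fact i = 0 ^ (Suc m - i) * c"
      by (rule LIM_unique)
    then show ?case using less.prems by (simp add: power_0_left)
  qed
  have "(\<lambda>t. p t / t ^ Suc m) \<midarrow>0\<rightarrow> (real_deriv ^^ Suc m) p 0 / fact (Suc m)"
    using zero by (rule quotient_limit_Taylor[OF assms(1)])
  then have c: "(real_deriv ^^ Suc m) p 0 / fact (Suc m) = c"
    using assms(2) by (rule LIM_unique)
  have "(\<lambda>t. real_deriv p t / t ^ m) \<midarrow>0\<rightarrow> (real_deriv ^^ m) (real_deriv p) 0 / fact m"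
  proof (rule quotient_limit_Taylor[OF smooth_at_real_deriv[OF assms(1)]])
    show "(real_deriv ^^ i) (real_deriv p) 0 = 0" if "i < m" for i
      using zero[of "Suc i"] that by (simp add: funpow_swap1)
  qed
  moreover have "(real_deriv ^^ m) (real_deriv p) 0 / fact m = real (Suc m) * c"
    unfolding c[symmetric] by (simp add: funpow_swap1 del: of_nat_Suc)
  ultimately show ?thesis by simp
qed

lemma smooth_at_frechet_field:
  fixes f :: "real^'n::finite \<Rightarrow> 'b::real_normed_vector" and \<eta> :: "real^'n \<Rightarrow> real^'n"
  assumes "smooth_at f a" "smooth_at \<eta> a"
  shows "smooth_at (\<lambda>x. frechet_derivative f (at x) (\<eta> x)) a"
proof (rule smooth_at_transform)
  show "smooth_at (\<lambda>x. \<Sum>i\<in>UNIV. \<eta> x $ i *\<^sub>R frechet_derivative f (at x) (axis i 1)) a"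
    by (intro smooth_at_sum smooth_at_scaleR smooth_at_nth smooth_at_frechet assms)
  show "\<forall>\<^sub>F x in nhds a. (\<Sum>i\<in>UNIV. \<eta> x $ i *\<^sub>R frechet_derivative f (at x) (axis i 1))
      = frechet_derivative f (at x) (\<eta> x)"
    using eventually_smooth_at[OF assms(1)]
  proof eventually_elim
    case (elim x)
    show ?case
      by (rule linear_eq_sum_axis[symmetric])
        (intro linear_frechet_derivative smooth_at_differentiable elim)
  qed
qed

lemma tendsto_frechet:
  fixes f :: "real^'n::finite \<Rightarrow> 'b::real_normed_vector"
  assumes "smooth_at f a" "(x \<longlongrightarrow> a) F" "(w \<longlongrightarrow> v) F"
  shows "((\<lambda>t. frechet_derivative f (at (x t)) (w t)) \<longlongrightarrow> frechet_derivative f (at a) v) F"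
proof -
  let ?D = "\<lambda>x. frechet_derivative f (at x)"
  have lim: "((\<lambda>t. ?D (x t) (axis i 1)) \<longlongrightarrow> ?D a (axis i 1)) F" for i
    by (rule isCont_tendsto_compose[OF smooth_at_continuous[OF smooth_at_frechet[OF assms(1)]] assms(2)])
  have "((\<lambda>t. \<Sum>i\<in>UNIV. w t $ i *\<^sub>R ?D (x t) (axis i 1)) \<longlongrightarrow> (\<Sum>i\<in>UNIV. v $ i *\<^sub>R ?D a (axis i 1))) F"
    by (intro tendsto_intros lim assms)
  moreover have "\<forall>\<^sub>F t in F. smooth_at f (x t)"
    using assms(2) eventually_smooth_at[OF assms(1)] by (auto simp: filterlim_iff)
  then have "\<forall>\<^sub>F t in F. (\<Sum>i\<in>UNIV. w t $ i *\<^sub>R ?D (x t) (axis i 1)) = ?D (x t) (w t)"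
  proof eventually_elim
    case (elim t)
    show ?case
      by (rule linear_eq_sum_axis[symmetric])
        (intro linear_frechet_derivative smooth_at_differentiable elim)
  qed
  moreover have "(\<Sum>i\<in>UNIV. v $ i *\<^sub>R ?D a (axis i 1)) = ?D a v"
    by (rule linear_eq_sum_axis[symmetric])
      (intro linear_frechet_derivative smooth_at_differentiable assms(1))
  ultimately show ?thesis by (simp add: Lim_transform_eventually)
qed

text \<open>Along the curve, eta is a(t) times the velocity plus an error E(t) = o(t^(k-1)). Hence a
  derivative along eta is a(t) times the derivative of the restriction to the curve, plus a term
  controlled by E. By induction the j-th derivative is a_0^j c k(k-1)...(k-j+1) t^(k-j) to leading
  order, and j = k gives the value at 0.\<close>

lemma iterated_dir_deriv_along_curve:
  fixes \<eta> :: "real^'n::finite \<Rightarrow> real^'n" and h :: "real^'n \<Rightarrow> real" and \<gamma> :: "real \<Rightarrow> real^'n"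
  assumes \<eta>: "smooth_at \<eta> 0" and h: "smooth_at h 0" and \<gamma>: "smooth_at \<gamma> 0" "\<gamma> 0 = 0"
    and a: "(a \<longlongrightarrow> a\<^sub>0) (at 0)"
    and tangent: "((\<lambda>t. (1 / t ^ (k - 1)) *\<^sub>R (\<eta> (\<gamma> t) - a t *\<^sub>R frechet_derivative \<gamma> (at t) 1)) \<longlongrightarrow> 0) (at 0)"
    and order: "((\<lambda>t. h (\<gamma> t) / t ^ k) \<longlongrightarrow> c) (at 0)"
  shows "(dir_deriv \<eta> ^^ k) h 0 = a\<^sub>0 ^ k * c * fact k"
proof -
  let ?\<psi> = "\<lambda>j. (dir_deriv \<eta> ^^ j) h"
  have \<gamma>lim: "(\<gamma> \<longlongrightarrow> 0) (at 0)" using smooth_at_continuous[OF \<gamma>(1)] \<gamma>(2) by (simp add: isCont_def)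
  have smooth: "smooth_at (?\<psi> j) 0" for j
  proof (induction j)
    case (Suc j)
    then show ?case using smooth_at_frechet_field[OF _ \<eta>] by (simp add: dir_deriv_def)
  qed (simp add: h)
  have along: "((\<lambda>t. ?\<psi> j (\<gamma> t) / t ^ (k - j)) \<longlongrightarrow> a\<^sub>0 ^ j * c * (\<Prod>i<j. real (k - i))) (at 0)"
    if "j \<le> k" for j
    using that
  proof (induction j)
    case 0
    then show ?case using order by simp
  next
    case (Suc j)
    let ?p = "\<lambda>t. ?\<psi> j (\<gamma> t)"
    obtain m where "k = Suc j + m" using Suc.prems le_Suc_ex by blast
    then have m: "k - j = Suc m" "k - Suc j = m" "k - 1 = j + m" by simp_all
    have p: "smooth_at ?p 0" 
      by (rule smooth_at_compose[OF \<gamma>(1)]) (simp add: \<gamma>(2) smooth)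
    have IH: "((\<lambda>t. ?p t / t ^ Suc m) \<longlongrightarrow> a\<^sub>0 ^ j * c * (\<Prod>i<j. real (k - i))) (at 0)"
      using Suc.IH Suc.prems m(1) by simp
    define E where "E = (\<lambda>t. \<eta> (\<gamma> t) - a t *\<^sub>R frechet_derivative \<gamma> (at t) 1)"
    \<comment> \<open>Here \<open>k - 1 = j + m\<close>, and the error has to be o(t^m). The assumed
      order is exactly what the first derivative, \<open>j = 0\<close>, requires; later ones have
      \<open>j\<close> powers to spare.\<close>
    have "((\<lambda>t. t ^ j *\<^sub>R ((1 / t ^ (k - 1)) *\<^sub>R E t)) \<longlongrightarrow> 0 ^ j *\<^sub>R 0) (at 0)"
      unfolding E_def by (intro tendsto_intros tangent)
    then have "((\<lambda>t. (1 / t ^ m) *\<^sub>R E t) \<longlongrightarrow> 0) (at 0)"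
    proof (rule Lim_transform_eventually[THEN tendsto_eq_rhs])
      show "\<forall>\<^sub>F t in at 0. t ^ j *\<^sub>R ((1 / t ^ (k - 1)) *\<^sub>R E t) = (1 / t ^ m) *\<^sub>R E t"
        unfolding eventually_at_filter m(3) by (simp add: power_add)
    qed simp
    from tendsto_frechet[OF smooth \<gamma>lim this]
    have rest: "((\<lambda>t. frechet_derivative (?\<psi> j) (at (\<gamma> t)) ((1 / t ^ m) *\<^sub>R E t)) \<longlongrightarrow> 0) (at 0)"
      using linear_0[OF linear_frechet_derivative[OF smooth_at_differentiable[OF smooth]]] by simp
    have main: "((\<lambda>t. a t * (real_deriv ?p t / t ^ m)) \<longlongrightarrow>
        a\<^sub>0 * (real (Suc m) * (a\<^sub>0 ^ j * c * (\<Prod>i<j. real (k - i))))) (at 0)"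
      by (intro tendsto_mult a quotient_limit_real_deriv[OF p IH])
    have ev1: "\<forall>\<^sub>F t in at 0. smooth_at (?\<psi> j) (\<gamma> t)"
      using \<gamma>lim eventually_smooth_at[OF smooth] by (auto simp: filterlim_iff)
    have ev2: "\<forall>\<^sub>F t in at 0. smooth_at \<gamma> t"
      using eventually_smooth_at[OF \<gamma>(1)] by (simp add: eventually_at_filter eventually_mono)
    have "((\<lambda>t. ?\<psi> (Suc j) (\<gamma> t) / t ^ m) \<longlongrightarrow>
        a\<^sub>0 * (real (Suc m) * (a\<^sub>0 ^ j * c * (\<Prod>i<j. real (k - i)))) + 0) (at 0)"
    proof (rule Lim_transform_eventually[OF tendsto_add[OF main rest]])
      show "\<forall>\<^sub>F t in at 0. a t * (real_deriv ?p t / t ^ m)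
          + frechet_derivative (?\<psi> j) (at (\<gamma> t)) ((1 / t ^ m) *\<^sub>R E t) = ?\<psi> (Suc j) (\<gamma> t) / t ^ m"
        using ev1 ev2
      proof eventually_elim
        case (elim t)
        let ?D = "frechet_derivative (?\<psi> j) (at (\<gamma> t))" and ?G = "frechet_derivative \<gamma> (at t)"
        have lin: "linear ?D" by (intro linear_frechet_derivative smooth_at_differentiable elim)
        have "(?p has_derivative (\<lambda>v. ?D (?G v))) (at t)"
          by (rule has_derivative_compose[OF smooth_at_has_derivative[OF elim(2)] smooth_at_has_derivative[OF elim(1)]])
        then have "real_deriv ?p t = ?D (?G 1)" by (simp add: real_deriv_def frechet_derivative_at[symmetric])
        moreover have "?\<psi> (Suc j) (\<gamma> t) = ?D (a t *\<^sub>R ?G 1 + E t)"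
          by (simp add: dir_deriv_def E_def)
        ultimately show ?case
          by (simp add: linear_add[OF lin] linear_scale[OF lin] add_divide_distrib)
      qed
    qed
    moreover have "(\<Prod>i<Suc j. real (k - i)) = real (Suc m) * (\<Prod>i<j. real (k - i))"
      by (simp only: prod.lessThan_Suc m(1) mult.commute)
    ultimately show ?case unfolding m(2) by (simp only: add_0_right power_Suc mult_ac)
  qed
  have "(\<Prod>i<k. real (k - i)) = fact k"
    by (simp add: fact_prod_rev atLeast0LessThan)
  then have "((\<lambda>t. ?\<psi> k (\<gamma> t)) \<longlongrightarrow> a\<^sub>0 ^ k * c * fact k) (at 0)"
    using along[of k] by simp
  moreover have "((\<lambda>t. ?\<psi> k (\<gamma> t)) \<longlongrightarrow> ?\<psi> k 0) (at 0)"
    using isCont_tendsto_compose[OF smooth_at_continuous[OF smooth] \<gamma>lim] .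
  ultimately show ?thesis by (rule LIM_unique[symmetric])
qed

section \<open>The Morin normal forms\<close>

text \<open>The bounds matter: \<open>ix 0\<close> coincides with \<open>ix 1\<close> because of
  truncated subtraction, and beyond \<open>CARD('n)\<close> the list access is unspecified.\<close>

lemma ix_eq_iff:
  assumes "1 \<le> i" "i \<le> CARD('n)" "1 \<le> j" "j \<le> CARD('n)"
  shows "(ix i :: 'n::{finite,linorder}) = ix j \<longleftrightarrow> i = j"
  using assms unfolding ix_def by (subst nth_eq_iff_index_eq) auto

definition morin_poly :: "nat \<Rightarrow> real^'n::{finite,linorder} \<Rightarrow> real" where
  "morin_poly k x = (\<Sum>j=2..k. x $ ix 1 ^ (j - 1) * x $ ix j) + x $ ix 1 ^ (k + 1)"

text \<open>The partial derivative of \<open>morin_poly k\<close> in x_1. At \<open>j = 2\<close>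
  the power of x_1 is 0, so x_2 enters with coefficient 1 and the zero set is a graph over the other
  coordinates once \<open>2 \<le> k\<close>.\<close>

definition morin_slope :: "nat \<Rightarrow> real^'n::{finite,linorder} \<Rightarrow> real" where
  "morin_slope k x = (\<Sum>j=2..k. real (j - 1) * x $ ix 1 ^ (j - 2) * x $ ix j) + real (k + 1) * x $ ix 1 ^ k"

text \<open>One family for the given normal form, the fold, and the signed forms with second sign 1;
  the sign can then be varied without changing the map.\<close>

definition morin_form :: "nat \<Rightarrow> real \<Rightarrow> real^'n::{finite,linorder} \<Rightarrow> real^'n::{finite,linorder}" where
  "morin_form k \<epsilon> x = (\<chi> i. if i = ix 1 then \<epsilon> * morin_poly k x else x $ i)"

lemma morin_normal_form_eq: "morin_normal_form k = morin_form k 1"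
  by (simp add: fun_eq_iff morin_normal_form_def morin_form_def morin_poly_def)

lemma morin_signed_eq: "2 \<le> k \<Longrightarrow> morin_signed k \<epsilon> 1 = morin_form k \<epsilon>"
  by (simp add: fun_eq_iff morin_signed_def morin_form_def morin_poly_def sum.atLeast_Suc_atMost
      vec_eq_iff numeral_3_eq_3 numeral_2_eq_2 mult_ac)

lemma fold_signed_eq: "fold_signed 1 = morin_form 1 1"
  by (simp add: fun_eq_iff fold_signed_def morin_form_def morin_poly_def power2_eq_square)

lemma smooth_at_coordinate: "smooth_at (\<lambda>x::real^'m. x $ i) a"
  by (rule smooth_at_linear) (rule bounded_linear_vec_nth)

lemma smooth_at_morin_poly: "smooth_at (morin_poly k) a"
  unfolding morin_poly_def[abs_def]
  by (intro smooth_at_add smooth_at_sum smooth_at_mult smooth_at_power smooth_at_coordinate)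

lemma smooth_at_morin_form: "smooth_at (morin_form k \<epsilon>) a"
  unfolding morin_form_def[abs_def]
proof (rule smooth_at_vec)
  fix i :: 'a
  show "smooth_at (\<lambda>x. if i = ix 1 then \<epsilon> * morin_poly k x else x $ i) a"
    by (cases "i = ix 1")
      (simp_all add: smooth_at_mult smooth_at_morin_poly smooth_at_coordinate)
qed

lemma morin_poly_zero: "morin_poly k 0 = 0"
  by (simp add: morin_poly_def)

lemma smooth_germ_morin_form: "smooth_germ (morin_form k \<epsilon>)"
  by (simp add: smooth_germ_iff smooth_at_morin_form morin_form_def morin_poly_zero vec_eq_iff)

section \<open>Derivative, Jacobian determinant and kernel of the normal forms\<close>

lemma frechet_derivative_nth:
  fixes f :: "'a::euclidean_space \<Rightarrow> real^'m"
  assumes "smooth_at f a"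
  shows "frechet_derivative f (at a) v $ i = frechet_derivative (\<lambda>x. f x $ i) (at a) v"
  using frechet_derivative_at[OF bounded_linear.has_derivative[OF bounded_linear_vec_nth
        smooth_at_has_derivative[OF assms]]] by metis

lemma frechet_derivative_morin_form:
  fixes x :: "real^'n::{finite,linorder}"
  shows "frechet_derivative (morin_form k \<epsilon>) (at x) v $ i =
    (if i = ix 1 then \<epsilon> * frechet_derivative (morin_poly k) (at x) v else v $ i)"
proof (cases "i = ix 1")
  case True
  have "((\<lambda>x. \<epsilon> * morin_poly k x) has_derivative (\<lambda>v. \<epsilon> * frechet_derivative (morin_poly k) (at x) v)) (at x)"
    by (intro has_derivative_mult_right smooth_at_has_derivative smooth_at_morin_poly)
  then show ?thesis
    unfolding frechet_derivative_nth[OF smooth_at_morin_form]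
    using True by (simp add: morin_form_def frechet_derivative_at[symmetric])
next
  case False
  have "((\<lambda>x. x $ i) has_derivative (\<lambda>v. v $ i)) (at x)"
    by (rule bounded_linear_imp_has_derivative) (rule bounded_linear_vec_nth)
  then show ?thesis
    unfolding frechet_derivative_nth[OF smooth_at_morin_form]
    using False by (simp add: morin_form_def frechet_derivative_at[symmetric])
qed

lemma frechet_derivative_morin_poly:
  fixes x :: "real^'n::{finite,linorder}"
  assumes "k \<le> CARD('n)"
  shows "frechet_derivative (morin_poly k) (at x) (axis (ix 1) 1) = morin_slope k x"
proof -
  have nth: "((\<lambda>x. x $ i) has_derivative (\<lambda>v. v $ i)) (at x)" for i
    by (rule bounded_linear_imp_has_derivative) (rule bounded_linear_vec_nth)
  have "(morin_poly k has_derivative (\<lambda>v.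
      (\<Sum>j=2..k. x $ ix 1 ^ (j - 1) * v $ ix j + (of_nat (j - 1) * v $ ix 1 * x $ ix 1 ^ (j - 1 - 1)) * x $ ix j)
      + of_nat (k + 1) * v $ ix 1 * x $ ix 1 ^ (k + 1 - 1))) (at x)"
    unfolding morin_poly_def[abs_def]
    by (intro has_derivative_add has_derivative_sum has_derivative_mult has_derivative_power nth)
  note D = frechet_derivative_at[OF this, symmetric]
  have "axis (ix 1) 1 $ (ix j :: 'n) = (0::real)" if "j \<in> {2..k}" for j
  proof -
    have "(ix j :: 'n) \<noteq> ix 1" using that assms by (subst ix_eq_iff) auto
    then show ?thesis by (simp add: axis_def)
  qed
  then show ?thesis
    unfolding D morin_slope_def by (simp add: mult_ac numeral_2_eq_2)
qed

text \<open>Cramer's rule for the identity matrix. The Jacobi matrix of a normal form differs from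
  the identity only in its first row, so its determinant is a single entry.\<close>

lemma det_one_row:
  fixes w :: "real^'m::finite"
  shows "det (\<chi> i. if i = k then w else axis i 1) = w $ k"
proof -
  have row: "row i (mat 1 :: real^'m^'m) = axis i 1" for i
    by (simp add: row_def mat_def axis_def vec_eq_iff)
  have "(\<Sum>i\<in>UNIV. w $ i *s row i (mat 1 :: real^'m^'m)) = w"
    by (simp add: row vec_eq_iff axis_def if_distrib[of "\<lambda>y. _ * y"] cong: if_cong)
  then show ?thesis
    using cramer_lemma_transpose[of k w "mat 1"] by (simp add: row cong: if_cong)
qed

lemma jacobian_det_morin_form:
  fixes x :: "real^'n::{finite,linorder}"
  assumes "k \<le> CARD('n)"
  shows "jacobian_det (morin_form k \<epsilon>) x = \<epsilon> * morin_slope k x"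
proof -
  let ?w = "\<chi> j. \<epsilon> * frechet_derivative (morin_poly k) (at x) (axis j 1) :: real^'n::{finite,linorder}"
  have "jacobian (morin_form k \<epsilon>) (at x) = (\<chi> i. if i = ix 1 then ?w else axis i 1)"
    by (auto simp: vec_eq_iff jacobian_entry frechet_derivative_morin_form axis_def)
  then show ?thesis
    by (simp add: jacobian_det_def det_one_row frechet_derivative_morin_poly[OF assms] del: One_nat_def)
qed

lemma morin_form_kernel:
  fixes x :: "real^'n::{finite,linorder}"
  assumes "frechet_derivative (morin_form k \<epsilon>) (at x) v = 0"
  shows "v = v $ ix 1 *\<^sub>R axis (ix 1) 1"
proof -
  have "v $ i = 0" if "i \<noteq> ix 1" for i
    using arg_cong[OF assms, of "\<lambda>y. y $ i"] that by (simp add: frechet_derivative_morin_form)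
  then show ?thesis by (auto simp: vec_eq_iff axis_def)
qed

lemma morin_axis:
  fixes t :: real
  assumes "k \<le> CARD('n::{finite,linorder})"
  shows "morin_poly k (t *\<^sub>R axis (ix 1) 1 :: real^'n::{finite,linorder}) = t ^ (k + 1)"
    and "morin_slope k (t *\<^sub>R axis (ix 1) 1 :: real^'n::{finite,linorder}) = real (k + 1) * t ^ k"
proof -
  have "axis (ix 1) 1 $ (ix j :: 'n) = (0::real)" if "j \<in> {2..k}" for j
  proof -
    have "(ix j :: 'n) \<noteq> ix 1" using that assms by (subst ix_eq_iff) auto
    then show ?thesis by (simp add: axis_def)
  qed
  then show "morin_poly k (t *\<^sub>R axis (ix 1) 1 :: real^'n::{finite,linorder}) = t ^ (k + 1)"
    "morin_slope k (t *\<^sub>R axis (ix 1) 1 :: real^'n::{finite,linorder}) = real (k + 1) * t ^ k"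
    by (simp_all add: morin_poly_def morin_slope_def)
qed

section \<open>Germs conjugate to a normal form\<close>

lemma frechet_derivative_compose:
  fixes g :: "'a::euclidean_space \<Rightarrow> 'c::euclidean_space"
  assumes "smooth_at g a" "smooth_at f (g a)"
  shows "frechet_derivative (\<lambda>x. f (g x)) (at a) v = frechet_derivative f (at (g a)) (frechet_derivative g (at a) v)"
  using frechet_derivative_at[OF has_derivative_compose[OF smooth_at_has_derivative[OF assms(1)]
        smooth_at_has_derivative[OF assms(2)]]] by metis

lemma smooth_at_jacobian_det:
  assumes "smooth_at f a"
  shows "smooth_at (jacobian_det f) a"
proof -
  have "jacobian_det f = (\<lambda>x. \<Sum>p | p permutes UNIV.
      of_int (sign p) * (\<Prod>i\<in>UNIV. frechet_derivative f (at x) (axis (p i) 1) $ i))"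
    by (simp add: fun_eq_iff jacobian_det_def det_def jacobian_entry)
  then show ?thesis
    by (simp only:) (intro smooth_at_sum smooth_at_mult smooth_at_const smooth_at_prod smooth_at_nth smooth_at_frechet assms)
qed

lemma eventually_smooth_at_germ:
  assumes "smooth_germ f"
  shows "\<forall>\<^sub>F x in nhds 0. smooth_at f x"
  using assms by (simp add: smooth_germ_iff eventually_smooth_at)

lemma left_inverse_derivative:
  fixes \<sigma> \<rho> :: "real^'m::finite \<Rightarrow> real^'m"
  assumes "smooth_germ \<sigma>" "smooth_germ \<rho>" "\<forall>\<^sub>F x in nhds 0. \<rho> (\<sigma> x) = x"
  shows "\<forall>\<^sub>F x in nhds 0. \<forall>v. frechet_derivative \<rho> (at (\<sigma> x)) (frechet_derivative \<sigma> (at x) v) = v"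
proof -
  have "\<forall>\<^sub>F x in nhds 0. \<forall>\<^sub>F y in nhds x. \<rho> (\<sigma> y) = y"
    using assms(3) by (simp add: eventually_eventually)
  then show ?thesis
    using eventually_smooth_at_germ[OF assms(1)]
      eventually_smooth_germ[OF assms(1) eventually_smooth_at_germ[OF assms(2)]]
  proof eventually_elim
    case (elim x)
    have "frechet_derivative (\<lambda>y. \<rho> (\<sigma> y)) (at x) = frechet_derivative (\<lambda>y. y) (at x)"
      by (rule frechet_derivative_cong[OF elim(1)])
    also have "\<dots> = (\<lambda>v. v)" by (rule frechet_derivative_at[symmetric]) (rule has_derivative_ident)
    finally show ?case using frechet_derivative_compose[OF elim(2,3)] by metis
  qed
qed

lemma positive_germ_smooth: "positive_germ \<sigma> \<Longrightarrow> smooth_germ \<sigma>"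
  by (simp add: positive_germ_def diffeo_germ_def)

lemma jacobian_det_tendsto:
  assumes "smooth_germ f" "(x \<longlongrightarrow> 0) F"
  shows "((\<lambda>t. jacobian_det f (x t)) \<longlongrightarrow> jacobian_det f 0) F"
  using assms smooth_at_jacobian_det smooth_at_continuous isCont_tendsto_compose
  unfolding smooth_germ_iff by blast

lemma eventually_jacobian_det_pos:
  assumes "positive_germ \<sigma>"
  shows "\<forall>\<^sub>F x in nhds 0. jacobian_det \<sigma> x > 0"
  by (rule order_tendstoD(1)[OF jacobian_det_tendsto[OF positive_germ_smooth[OF assms] filterlim_ident]])
    (use assms in \<open>simp add: positive_germ_def\<close>)

lemma positive_germ_inverse:
  fixes \<sigma> :: "real^'m::finite \<Rightarrow> real^'m"
  assumes "positive_germ \<sigma>"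
  obtains \<rho> where "positive_germ \<rho>" "\<forall>\<^sub>F x in nhds 0. \<rho> (\<sigma> x) = x" "\<forall>\<^sub>F x in nhds 0. \<sigma> (\<rho> x) = x"
proof -
  have \<sigma>: "diffeo_germ \<sigma>" "jacobian_det \<sigma> 0 > 0" using assms by (simp_all add: positive_germ_def)
  obtain \<rho> where \<rho>: "diffeo_germ \<rho>" "\<forall>\<^sub>F x in nhds 0. \<rho> (\<sigma> x) = x" "\<forall>\<^sub>F x in nhds 0. \<sigma> (\<rho> x) = x"
    by (rule diffeo_germ_inverse[OF \<sigma>(1)])
  have "jacobian_det (\<lambda>x. \<rho> (\<sigma> x)) 0 = jacobian_det (\<lambda>x::real^'m. mat 1 *v x) 0"
    by (rule jacobian_det_cong) (use \<rho>(2) in simp)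
  then have "jacobian_det \<rho> 0 * jacobian_det \<sigma> 0 = 1"
    using \<sigma> \<rho>(1) diffeo_germ_zero[OF \<sigma>(1)]
    by (subst (asm) jacobian_det_compose) (auto simp: jacobian_det_linear diffeo_germ_differentiable)
  then have "jacobian_det \<rho> 0 > 0"
    using \<sigma>(2) by (metis zero_less_mult_pos2 zero_less_one)
  then show ?thesis using \<rho> that by (simp add: positive_germ_def)
qed

text \<open>The chain rule on both sides of the conjugacy. When \<rho> and \<open>T\<close> preserve
  orientation, the determinants of both are positive near 0, so in the coordinates \<open>z\<close>
  the singular set is the zero set of \<open>morin_slope k\<close> and the sign of \<epsilon> is
  preserved.\<close>

lemma conjugate_jacobian_det:
  fixes f \<rho> T :: "real^'n::{finite,linorder} \<Rightarrow> real^'n::{finite,linorder}"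
  assumes "k \<le> CARD('n)" "smooth_germ f" "smooth_germ \<rho>" "smooth_germ T"
    and "\<forall>\<^sub>F y in nhds 0. f (\<rho> y) = T (morin_form k \<epsilon> y)"
  shows "\<forall>\<^sub>F z in nhds 0. jacobian_det f (\<rho> z) * jacobian_det \<rho> z
    = jacobian_det T (morin_form k \<epsilon> z) * (\<epsilon> * morin_slope k z)"
proof -
  have "\<forall>\<^sub>F z in nhds 0. \<forall>\<^sub>F y in nhds z. f (\<rho> y) = T (morin_form k \<epsilon> y)"
    using assms(5) by (simp add: eventually_eventually)
  then show ?thesis
    using eventually_smooth_at_germ[OF assms(3)]
      eventually_smooth_germ[OF assms(3) eventually_smooth_at_germ[OF assms(2)]]
      eventually_smooth_germ[OF smooth_germ_morin_form eventually_smooth_at_germ[OF assms(4)], of k \<epsilon>]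
  proof eventually_elim
    case (elim z)
    have "jacobian_det (\<lambda>y. f (\<rho> y)) z = jacobian_det (\<lambda>y. T (morin_form k \<epsilon> y)) z"
      by (rule jacobian_det_cong[OF elim(1)])
    moreover have "jacobian_det (\<lambda>y. f (\<rho> y)) z = jacobian_det f (\<rho> z) * jacobian_det \<rho> z"
      using elim(2,3) by (intro jacobian_det_compose smooth_at_differentiable)
    moreover have "jacobian_det (\<lambda>y. T (morin_form k \<epsilon> y)) z
        = jacobian_det T (morin_form k \<epsilon> z) * jacobian_det (morin_form k \<epsilon>) z"
      using elim(4) by (intro jacobian_det_compose smooth_at_differentiable smooth_at_morin_form)
    ultimately show ?case by (simp add: jacobian_det_morin_form[OF assms(1)])
  qed
qed

lemma tendsto_axis: "((\<lambda>t. t *\<^sub>R axis i (1::real)) \<longlongrightarrow> (0 :: real^'m::finite)) (nhds 0)"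
proof -
  have "((\<lambda>t. t *\<^sub>R axis i (1::real)) \<longlongrightarrow> (0 *\<^sub>R axis i 1 :: real^'m)) (nhds 0)"
    by (intro tendsto_intros filterlim_ident)
  then show ?thesis by simp
qed

lemma at_le_nhds: "filterlim f F (nhds a) \<Longrightarrow> filterlim f F (at a)"
  unfolding at_within_def by (erule filterlim_mono[OF _ order_refl inf_le1])

lemma jacobian_det_along_axis:
  fixes f \<rho> T :: "real^'n::{finite,linorder} \<Rightarrow> real^'n::{finite,linorder}"
  assumes "k \<le> CARD('n)" "smooth_germ f" "positive_germ \<rho>" "positive_germ T"
    and "\<forall>\<^sub>F y in nhds 0. f (\<rho> y) = T (morin_form k \<epsilon> y)"
  shows "((\<lambda>t. jacobian_det f (\<rho> (t *\<^sub>R axis (ix 1) 1)) / t ^ k) \<longlongrightarrow>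
    jacobian_det T 0 * (\<epsilon> * real (k + 1)) / jacobian_det \<rho> 0) (at 0)"
proof -
  let ?u = "\<lambda>t. t *\<^sub>R axis (ix 1) 1 :: real^'n::{finite,linorder}" and ?g = "morin_form k \<epsilon>"
  note sm = positive_germ_smooth[OF assms(3)] positive_germ_smooth[OF assms(4)]
  have u: "(?u \<longlongrightarrow> 0) (at 0)" by (rule at_le_nhds[OF tendsto_axis])
  have gu: "((\<lambda>t. ?g (?u t)) \<longlongrightarrow> 0) (at 0)"
    by (rule filterlim_compose[OF smooth_germ_tendsto[OF smooth_germ_morin_form] u])
  have "((\<lambda>t. jacobian_det T (?g (?u t)) * (\<epsilon> * real (k + 1)) / jacobian_det \<rho> (?u t)) \<longlongrightarrow>
    jacobian_det T 0 * (\<epsilon> * real (k + 1)) / jacobian_det \<rho> 0) (at 0)"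
    using assms(3) by (intro tendsto_intros jacobian_det_tendsto sm gu u) (simp add: positive_germ_def)
  then show ?thesis
  proof (rule Lim_transform_eventually)
    have "\<forall>\<^sub>F t in at 0. jacobian_det f (\<rho> (?u t)) * jacobian_det \<rho> (?u t)
        = jacobian_det T (?g (?u t)) * (\<epsilon> * morin_slope k (?u t))"
      using conjugate_jacobian_det[OF assms(1,2) sm assms(5)] u by (rule eventually_compose_filterlim)
    moreover have "\<forall>\<^sub>F t in at 0. jacobian_det \<rho> (?u t) > 0"
      using eventually_jacobian_det_pos[OF assms(3)] u by (rule eventually_compose_filterlim)
    ultimately show "\<forall>\<^sub>F t in at 0. jacobian_det T (?g (?u t)) * (\<epsilon> * real (k + 1)) / jacobian_det \<rho> (?u t)
        = jacobian_det f (\<rho> (?u t)) / t ^ k"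
      using eventually_neq_at_within[of 0 0 UNIV]
    proof eventually_elim
      case (elim t)
      then show ?case by (simp add: morin_axis[OF assms(1)] divide_simps mult_ac del: One_nat_def)
    qed
  qed
qed

text \<open>Instance of \<open>iterated_dir_deriv_along_curve\<close> for the image under \<rho> of
  the x_1-axis. The number \<open>a\<close> is the x_1-component at 0 of the null field in
  normal-form coordinates; its sign depends on the choice of the field.\<close>

lemma iterated_dir_deriv_morin:
  fixes f \<eta> \<rho> T :: "real^'n::{finite,linorder} \<Rightarrow> real^'n::{finite,linorder}"
  assumes k: "2 \<le> k" "k \<le> CARD('n)"
    and f: "smooth_germ f" and null: "null_vector_field f \<eta>"
    and \<rho>: "positive_germ \<rho>" and T: "positive_germ T"
    and conj: "\<forall>\<^sub>F y in nhds 0. f (\<rho> y) = T (morin_form k \<epsilon> y)"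
  obtains a c where "a \<noteq> 0" "c > 0" "(dir_deriv \<eta> ^^ k) (jacobian_det f) 0 = a ^ k * (\<epsilon> * c)"
proof -
  let ?g = "morin_form k \<epsilon>" and ?e = "axis (ix 1) 1 :: real^'n::{finite,linorder}"
  note smooth = positive_germ_smooth[OF \<rho>] positive_germ_smooth[OF T]
  obtain S where S: "positive_germ S" "\<forall>\<^sub>F x in nhds 0. S (\<rho> x) = x" "\<forall>\<^sub>F x in nhds 0. \<rho> (S x) = x"
    by (rule positive_germ_inverse[OF \<rho>])
  obtain T' where T': "positive_germ T'" "\<forall>\<^sub>F x in nhds 0. T' (T x) = x"
    by (rule positive_germ_inverse[OF T])
  obtain U where U: "0 \<in> U" "smooth_on U \<eta>"
    "\<And>p. p \<in> U \<Longrightarrow> \<eta> p \<noteq> 0 \<and> (jacobian_det f p = 0 \<longrightarrow> frechet_derivative f (at p) (\<eta> p) = 0)"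
    using null unfolding null_vector_field_def by blast
  have openU: "open U" using U(2) by (simp add: smooth_on_def)
  have \<eta>: "smooth_at \<eta> 0"
    unfolding smooth_at_def using U(1) openU smooth_on_imp_C_on[OF U(2)] by blast
  have "\<forall>\<^sub>F p in nhds 0. \<eta> p \<noteq> 0 \<and> (jacobian_det f p = 0 \<longrightarrow> frechet_derivative f (at p) (\<eta> p) = 0)"
    using eventually_nhds_in_open[OF openU U(1)] by eventually_elim (rule U(3))
  from eventually_smooth_germ[OF smooth(1) this]
  have null_ev: "\<forall>\<^sub>F z in nhds 0. jacobian_det f (\<rho> z) = 0 \<longrightarrow> frechet_derivative f (at (\<rho> z)) (\<eta> (\<rho> z)) = 0"
    by eventually_elim simp
  have \<rho>0: "\<rho> 0 = 0" using smooth(1) by (simp add: smooth_germ_iff)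
  \<comment> \<open>The null field pulled back to the coordinates of the normal form;
    \<open>M\<close> below is the image of the x_1-direction under the derivative of \<rho>.\<close>
  define \<xi> where "\<xi> = (\<lambda>z. frechet_derivative S (at (\<rho> z)) (\<eta> (\<rho> z)))"
  define M where "M = (\<lambda>z. frechet_derivative \<rho> (at z) ?e)"
  have \<xi>_smooth: "smooth_at \<xi> 0"
    unfolding \<xi>_def
    by (rule smooth_at_compose[where f="\<lambda>x. frechet_derivative S (at x) (\<eta> x)"])
      (use smooth positive_germ_smooth[OF S(1)] \<eta> in \<open>auto simp: smooth_germ_iff intro!: smooth_at_frechet_field\<close>)
  have N_smooth: "smooth_at (\<lambda>z. \<eta> (\<rho> z)) 0"
    by (rule smooth_at_compose[where f=\<eta>]) (use smooth(1) \<eta> in \<open>simp_all add: smooth_germ_iff\<close>)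
  have M_smooth: "smooth_at M 0"
    unfolding M_def using smooth(1) by (intro smooth_at_frechet) (simp add: smooth_germ_iff)
  have push: "\<forall>\<^sub>F z in nhds 0. \<eta> (\<rho> z) = frechet_derivative \<rho> (at z) (\<xi> z)"
    using eventually_smooth_germ[OF smooth(1) left_inverse_derivative[OF positive_germ_smooth[OF S(1)] smooth(1) S(3)]] S(2)
    by eventually_elim (simp add: \<xi>_def)
  have T_inj: "\<forall>\<^sub>F z in nhds 0. \<forall>v. frechet_derivative T (at (?g z)) v = 0 \<longrightarrow> v = 0"
  proof -
    have "\<forall>\<^sub>F x in nhds 0. smooth_at T' (T x)"
      by (rule eventually_smooth_germ[OF smooth(2) eventually_smooth_at_germ[OF positive_germ_smooth[OF T'(1)]]])
    then have "\<forall>\<^sub>F x in nhds 0. \<forall>v. frechet_derivative T (at x) v = 0 \<longrightarrow> v = 0"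
      using left_inverse_derivative[OF smooth(2) positive_germ_smooth[OF T'(1)] T'(2)]
    proof eventually_elim
      case (elim x)
      have "frechet_derivative T' (at (T x)) 0 = 0"
        by (intro linear_0 linear_frechet_derivative smooth_at_differentiable elim)
      then show ?case using elim(2) by metis
    qed
    then show ?thesis by (rule eventually_smooth_germ[OF smooth_germ_morin_form])
  qed
  have "\<forall>\<^sub>F z in nhds 0. \<forall>\<^sub>F y in nhds z. f (\<rho> y) = T (?g y)"
    using conj by (simp add: eventually_eventually)
  \<comment> \<open>At singular points the pulled-back field is annihilated by the derivative of T
    after the normal form. Injectivity of the derivative of \<open>T\<close> removes
    \<open>T\<close>, and the kernel of the normal form is spanned by the x_1-direction.\<close>
  then have "\<forall>\<^sub>F z in nhds 0. morin_slope k z = 0 \<longrightarrow> \<xi> z = \<xi> z $ ix 1 *\<^sub>R ?e"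
    using push T_inj null_ev conjugate_jacobian_det[OF k(2) f smooth conj] eventually_jacobian_det_pos[OF \<rho>]
      eventually_smooth_at_germ[OF smooth(1)]
      eventually_smooth_germ[OF smooth(1) eventually_smooth_at_germ[OF f]]
      eventually_smooth_germ[OF smooth_germ_morin_form eventually_smooth_at_germ[OF smooth(2)], of k \<epsilon>]
  proof eventually_elim
    case (elim z)
    show ?case
    proof
      assume "morin_slope k z = 0"
      then have "jacobian_det f (\<rho> z) = 0" using elim(5,6) by simp
      then have "frechet_derivative f (at (\<rho> z)) (frechet_derivative \<rho> (at z) (\<xi> z)) = 0"
        using elim(2,4) by simp
      then have "frechet_derivative (\<lambda>y. T (?g y)) (at z) (\<xi> z) = 0"
        using frechet_derivative_compose[OF elim(7,8)] frechet_derivative_cong[OF elim(1)] by simp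
      then have "frechet_derivative T (at (?g z)) (frechet_derivative ?g (at z) (\<xi> z)) = 0"
        using frechet_derivative_compose[OF smooth_at_morin_form elim(9)] by simp
      then have "frechet_derivative ?g (at z) (\<xi> z) = 0" using elim(3) by blast
      then show "\<xi> z = \<xi> z $ ix 1 *\<^sub>R ?e" by (rule morin_form_kernel)
    qed
  qed
  then have on_singular: "\<forall>\<^sub>F z in nhds 0. morin_slope k z = 0 \<longrightarrow> \<eta> (\<rho> z) = \<xi> z $ ix 1 *\<^sub>R M z"
    using push eventually_smooth_at_germ[OF smooth(1)]
  proof eventually_elim
    case (elim z)
    have lin: "linear (frechet_derivative \<rho> (at z))"
      by (intro linear_frechet_derivative smooth_at_differentiable elim)
    show ?case
    proof
      assume "morin_slope k z = 0"
      then have "\<xi> z = \<xi> z $ ix 1 *\<^sub>R ?e" using elim(1) by blast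
      then have "frechet_derivative \<rho> (at z) (\<xi> z) = \<xi> z $ ix 1 *\<^sub>R M z"
        unfolding M_def linear_scale[OF lin, symmetric] by (rule arg_cong)
      then show "\<eta> (\<rho> z) = \<xi> z $ ix 1 *\<^sub>R M z" using elim(2) by simp
    qed
  qed
  define u where "u = (\<lambda>t. t *\<^sub>R ?e)"
  \<comment> \<open>\<open>w\<close> lies on the singular set, within \<open>O(t\<^sup>k)\<close> of the \<open>x\<^sub>1\<close>-axis \<open>u\<close>.\<close>
  define w where "w = (\<lambda>t. u t - (real (k + 1) * t ^ k) *\<^sub>R axis (ix 2) 1)"
  have ix12: "(ix 2 :: 'n) \<noteq> ix 1" using k by (subst ix_eq_iff) auto
  \<comment> \<open>Of the coordinates x_2, ..., x_k only x_2 is nonzero on \<open>w\<close>;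
    entering with coefficient 1, it cancels the term (k+1) t^k.\<close>
  have w_slope: "morin_slope k (w t) = 0" for t
  proof -
    have ixj: "(ix j :: 'n) \<noteq> ix 1 \<and> (ix j :: 'n) \<noteq> ix 2" if "j \<in> {Suc 2..k}" for j
      using that k by (auto simp: ix_eq_iff)
    have "(\<Sum>j=2..k. real (j - 1) * w t $ ix 1 ^ (j - 2) * w t $ ix j)
        = w t $ ix 2 + (\<Sum>j=Suc 2..k. real (j - 1) * w t $ ix 1 ^ (j - 2) * w t $ ix j)"
      by (subst sum.atLeast_Suc_atMost[OF k(1)]) simp
    moreover have "(\<Sum>j=Suc 2..k. real (j - 1) * w t $ ix 1 ^ (j - 2) * w t $ ix j) = 0"
    proof (rule sum.neutral, rule ballI)
      fix j assume "j \<in> {Suc 2..k}"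
      then have "w t $ ix j = 0" using ixj[of j] by (simp add: w_def u_def axis_def)
      then show "real (j - 1) * w t $ ix 1 ^ (j - 2) * w t $ ix j = 0" by simp
    qed
    moreover have "w t $ ix 2 = - (real (k + 1) * t ^ k)" "w t $ ix 1 = t"
      using ix12 by (simp_all add: w_def u_def axis_def)
    ultimately show ?thesis by (simp add: morin_slope_def)
  qed
  have u_lim: "(u \<longlongrightarrow> 0) (nhds 0)" unfolding u_def by (rule tendsto_axis)
  have w_lim: "(w \<longlongrightarrow> 0) (nhds 0)"
  proof -
    have "(w \<longlongrightarrow> 0 - (real (k + 1) * 0 ^ k) *\<^sub>R axis (ix 2) 1) (nhds 0)"
      unfolding w_def by (intro tendsto_intros u_lim filterlim_ident)
    then show ?thesis using k by (simp add: power_0_left)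
  qed
  \<comment> \<open>The factor is taken at \<open>w t\<close>, where the field is exactly a multiple
    of \<open>M\<close>, and then used at the nearby point \<open>u t\<close> of the axis.\<close>
  define a where "a = (\<lambda>t. \<xi> (w t) $ ix 1)"
  define a\<^sub>0 where "a\<^sub>0 = \<xi> 0 $ ix 1"
  have a: "(a \<longlongrightarrow> a\<^sub>0) (at 0)"
    unfolding a_def a\<^sub>0_def
    by (intro tendsto_vec_nth isCont_tendsto_compose[OF smooth_at_continuous[OF \<xi>_smooth]] at_le_nhds[OF w_lim])
  have "a\<^sub>0 \<noteq> 0"
  proof
    assume "a\<^sub>0 = 0"
    \<comment> \<open>The origin is \<open>w 0\<close>, hence singular, so a zero factor there would
      make the null field vanish at 0.\<close>
    moreover have "morin_slope k (0 :: real^'n::{finite,linorder}) = 0" using w_slope[of 0] k by (simp add: w_def u_def power_0_left)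
    ultimately have "\<eta> 0 = 0"
      using eventually_nhds_x_imp_x[OF on_singular] \<rho>0 by (simp add: a\<^sub>0_def)
    then show False using U by blast
  qed
  define \<gamma> where "\<gamma> = (\<lambda>t. \<rho> (u t))"
  have u_smooth: "smooth_at u t" for t
    unfolding u_def by (rule smooth_at_linear) (rule bounded_linear_scaleR_left)
  have u0: "u 0 = 0" by (simp add: u_def)
  have \<gamma>: "smooth_at \<gamma> 0" "\<gamma> 0 = 0"
    unfolding \<gamma>_def using smooth(1)
    by (simp_all add: smooth_at_compose[OF u_smooth, where f=\<rho>] u0 \<rho>0 smooth_germ_iff)
  have \<gamma>_deriv: "\<forall>\<^sub>F t in at 0. frechet_derivative \<gamma> (at t) 1 = M (u t)"
    using eventually_compose_filterlim[OF eventually_smooth_at_germ[OF smooth(1)] at_le_nhds[OF u_lim]]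
  proof eventually_elim
    case (elim t)
    have "(u has_derivative (\<lambda>s. s *\<^sub>R ?e)) (at t)"
      unfolding u_def by (rule bounded_linear_imp_has_derivative) (rule bounded_linear_scaleR_left)
    then have "frechet_derivative u (at t) 1 = ?e"
      by (simp add: frechet_derivative_at[symmetric])
    then show ?case
      unfolding \<gamma>_def M_def by (simp add: frechet_derivative_compose[OF u_smooth elim])
  qed
  obtain \<delta>\<^sub>1 L\<^sub>1 where L1: "\<delta>\<^sub>1 > 0" "L\<^sub>1 \<ge> 0"
    "\<And>x y. x \<in> ball 0 \<delta>\<^sub>1 \<Longrightarrow> y \<in> ball 0 \<delta>\<^sub>1 \<Longrightarrow> norm (\<eta> (\<rho> x) - \<eta> (\<rho> y)) \<le> L\<^sub>1 * norm (x - y)"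
    using smooth_at_lipschitz[OF N_smooth] by blast
  obtain \<delta>\<^sub>2 L\<^sub>2 where L2: "\<delta>\<^sub>2 > 0" "L\<^sub>2 \<ge> 0"
    "\<And>x y. x \<in> ball 0 \<delta>\<^sub>2 \<Longrightarrow> y \<in> ball 0 \<delta>\<^sub>2 \<Longrightarrow> norm (M x - M y) \<le> L\<^sub>2 * norm (x - y)"
    using smooth_at_lipschitz[OF M_smooth] by blast
  have near: "\<forall>\<^sub>F t in at 0. v t \<in> ball 0 \<delta>" if "(v \<longlongrightarrow> 0) (nhds 0)" "\<delta> > 0" for v :: "real \<Rightarrow> real^'n::{finite,linorder}" and \<delta>
    using tendstoD[OF at_le_nhds[OF that(1)] that(2)] by (simp add: dist_commute)
  \<comment> \<open>Passing from \<open>w t\<close> to \<open>u t\<close> changes the field and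
    \<open>M\<close> by O(t^k), both being Lipschitz; after division by t^(k-1) one factor t
    remains.\<close>
  have tangent: "((\<lambda>t. (1 / t ^ (k - 1)) *\<^sub>R (\<eta> (\<gamma> t) - a t *\<^sub>R frechet_derivative \<gamma> (at t) 1)) \<longlongrightarrow> 0) (at 0)"
  proof (rule Lim_null_comparison)
    have "((\<lambda>t. (L\<^sub>1 + \<bar>a t\<bar> * L\<^sub>2) * (real (k + 1) * \<bar>t\<bar>)) \<longlongrightarrow> (L\<^sub>1 + \<bar>a\<^sub>0\<bar> * L\<^sub>2) * (real (k + 1) * \<bar>0\<bar>)) (at 0)"
      by (intro tendsto_intros a)
    then show "((\<lambda>t. (L\<^sub>1 + \<bar>a t\<bar> * L\<^sub>2) * (real (k + 1) * \<bar>t\<bar>)) \<longlongrightarrow> 0) (at 0)" by simp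
    show "\<forall>\<^sub>F t in at 0. norm ((1 / t ^ (k - 1)) *\<^sub>R (\<eta> (\<gamma> t) - a t *\<^sub>R frechet_derivative \<gamma> (at t) 1))
        \<le> (L\<^sub>1 + \<bar>a t\<bar> * L\<^sub>2) * (real (k + 1) * \<bar>t\<bar>)"
      using \<gamma>_deriv eventually_compose_filterlim[OF on_singular at_le_nhds[OF w_lim]]
        near[OF u_lim L1(1)] near[OF w_lim L1(1)] near[OF u_lim L2(1)] near[OF w_lim L2(1)]
        eventually_neq_at_within[of 0 0 UNIV]
    proof eventually_elim
      case (elim t)
      have uw: "norm (u t - w t) = real (k + 1) * \<bar>t\<bar> ^ k"
        by (simp add: w_def power_abs abs_mult)
      have eq: "\<eta> (\<gamma> t) - a t *\<^sub>R frechet_derivative \<gamma> (at t) 1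
          = (\<eta> (\<rho> (u t)) - \<eta> (\<rho> (w t))) - a t *\<^sub>R (M (u t) - M (w t))"
        using elim(1,2) w_slope[of t] by (simp add: \<gamma>_def a_def algebra_simps)
      have "norm (\<eta> (\<gamma> t) - a t *\<^sub>R frechet_derivative \<gamma> (at t) 1)
          \<le> norm (\<eta> (\<rho> (u t)) - \<eta> (\<rho> (w t))) + \<bar>a t\<bar> * norm (M (u t) - M (w t))"
        unfolding eq by (rule order_trans[OF norm_triangle_ineq4]) simp
      also have "\<dots> \<le> L\<^sub>1 * norm (u t - w t) + \<bar>a t\<bar> * (L\<^sub>2 * norm (u t - w t))"
        by (intro add_mono mult_left_mono L1(3) L2(3) elim abs_ge_zero)
      also have "\<dots> = (L\<^sub>1 + \<bar>a t\<bar> * L\<^sub>2) * (real (k + 1) * \<bar>t\<bar> ^ k)"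
        by (simp add: uw algebra_simps)
      finally have "norm ((1 / t ^ (k - 1)) *\<^sub>R (\<eta> (\<gamma> t) - a t *\<^sub>R frechet_derivative \<gamma> (at t) 1))
          \<le> 1 / \<bar>t\<bar> ^ (k - 1) * ((L\<^sub>1 + \<bar>a t\<bar> * L\<^sub>2) * (real (k + 1) * \<bar>t\<bar> ^ k))"
        unfolding norm_scaleR by (simp add: power_abs divide_right_mono)
      also have "\<dots> = (L\<^sub>1 + \<bar>a t\<bar> * L\<^sub>2) * (real (k + 1) * \<bar>t\<bar>)"
      proof -
        have "\<bar>t\<bar> ^ k = \<bar>t\<bar> ^ (k - 1) * \<bar>t\<bar>" using k(1) by (simp add: power_eq_if)
        then show ?thesis using elim(7) by simp
      qed
      finally show ?case .
    qed
  qed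
  have order: "((\<lambda>t. jacobian_det f (\<gamma> t) / t ^ k) \<longlongrightarrow>
      jacobian_det T 0 * (\<epsilon> * real (k + 1)) / jacobian_det \<rho> 0) (at 0)"
    unfolding \<gamma>_def u_def by (rule jacobian_det_along_axis[OF k(2) f \<rho> T conj])
  have "smooth_at (jacobian_det f) 0"
    using f by (simp add: smooth_germ_iff smooth_at_jacobian_det)
  from iterated_dir_deriv_along_curve[OF \<eta> this \<gamma> a tangent order]
  have "(dir_deriv \<eta> ^^ k) (jacobian_det f) 0
      = a\<^sub>0 ^ k * (\<epsilon> * (jacobian_det T 0 * real (k + 1) / jacobian_det \<rho> 0 * fact k))"
    by simp
  moreover have "jacobian_det T 0 * real (k + 1) / jacobian_det \<rho> 0 * fact k > 0"
    using \<rho> T by (simp add: positive_germ_def)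
  ultimately show ?thesis using that[OF \<open>a\<^sub>0 \<noteq> 0\<close>] by blast
qed

section \<open>Germs with equal jets, and the two signs for even k\<close>

lemma smooth_at_det: "smooth_at (det :: real^'n^'n \<Rightarrow> real) A"
proof -
  have "smooth_at (\<lambda>M :: real^'n^'n. M $ i $ j) A" for i j
    by (rule smooth_at_linear) (rule bounded_linear_compose[OF bounded_linear_vec_nth bounded_linear_vec_nth])
  then show ?thesis
    unfolding det_def[abs_def]
    by (intro smooth_at_sum smooth_at_mult smooth_at_const smooth_at_prod)
qed

lemma tendsto_jacobian:
  fixes f :: "real^'n \<Rightarrow> real^'n"
  assumes "smooth_germ f" "(x \<longlongrightarrow> 0) F"
  shows "((\<lambda>t. jacobian f (at (x t))) \<longlongrightarrow> jacobian f (at 0)) F"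
proof -
  have "((\<lambda>t. frechet_derivative f (at (x t)) (axis j 1)) \<longlongrightarrow> frechet_derivative f (at 0) (axis j 1)) F" for j
    using assms by (intro tendsto_frechet tendsto_const) (auto simp: smooth_germ_iff)
  then show ?thesis
    by (intro vec_tendstoI) (simp add: jacobian_entry tendsto_vec_nth)
qed

lemma norm_matrix_le: "norm (A :: real^'n^'m) \<le> (\<Sum>i\<in>UNIV. \<Sum>j\<in>UNIV. \<bar>A $ i $ j\<bar>)"
proof -
  have "norm A \<le> (\<Sum>i\<in>UNIV. norm (A $ i))"
    unfolding norm_vec_def by (rule L2_set_le_sum) simp
  also have "\<dots> \<le> (\<Sum>i\<in>UNIV. \<Sum>j\<in>UNIV. \<bar>A $ i $ j\<bar>)"
    by (intro sum_mono norm_le_l1_cart)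
  finally show ?thesis .
qed

text \<open>The difference of the germs is flat to order \<open>Suc m\<close>, so its first
  derivatives are flat to order \<open>m\<close> and of size O(|x|^(m+1)). The determinant is
  Lipschitz near the common linear part, so the determinants inherit this bound.\<close>

lemma jacobian_det_flat_difference:
  fixes f g :: "real^'n::finite \<Rightarrow> real^'n"
  assumes f: "smooth_germ f" and g: "smooth_germ g" and jets: "jet r f = jet r g" "Suc m \<le> r"
  shows "\<exists>C. \<forall>\<^sub>F x in nhds 0. \<bar>jacobian_det f x - jacobian_det g x\<bar> \<le> C * norm x ^ Suc m"
    and "\<exists>C. \<forall>\<^sub>F x in nhds 0. norm (f x - g x) \<le> C * norm x ^ Suc m"
proof -
  define h where "h = (\<lambda>x. f x - g x)"
  have sm: "smooth_at f 0" "smooth_at g 0" using f g by (simp_all add: smooth_germ_iff)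
  have h: "smooth_at h 0" unfolding h_def by (rule smooth_at_diff[OF sm])
  have flat: "pderivs is h 0 = 0" if "length is \<le> Suc m" for "is"
  proof -
    have "pderivs is f 0 = pderivs is g 0"
      using fun_cong[OF jets(1), of "is"] that jets(2) by (simp add: jet_def)
    then show ?thesis
      using eventually_nhds_x_imp_x[OF pderivs_diff[OF sm, of "is"]] by (simp add: h_def)
  qed
  show "\<exists>C. \<forall>\<^sub>F x in nhds 0. norm (f x - g x) \<le> C * norm x ^ Suc m"
    using flat_bound[OF h, of m] flat unfolding h_def by fastforce
  have "\<exists>C\<ge>0. \<forall>\<^sub>F x in nhds 0. norm (pderivs [i] h x) \<le> C * norm x ^ Suc m" for i
  proof (rule flat_bound[OF smooth_at_pderivs[OF h]])
    show "pderivs is (pderivs [i] h) 0 = 0" if "length is \<le> m" for "is"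
      unfolding pderivs_append[symmetric] using that by (intro flat) simp
  qed
  then have "\<forall>i. \<exists>C\<ge>0. \<forall>\<^sub>F x in nhds 0. norm (pderivs [i] h x) \<le> C * norm x ^ Suc m" ..
  from choice[OF this] obtain C where C: "\<And>i. C i \<ge> 0"
    "\<And>i. \<forall>\<^sub>F x in nhds 0. norm (pderivs [i] h x) \<le> C i * norm x ^ Suc m" by blast
  have "\<forall>\<^sub>F x in nhds 0. \<forall>i. norm (pderivs [i] h x) \<le> C i * norm x ^ Suc m"
    by (simp only: eventually_all_finite C(2) simp_thms)
  moreover have "\<forall>\<^sub>F x in nhds 0. \<forall>i. pderivs [i] h x = pderivs [i] f x - pderivs [i] g x"
    using pderivs_diff[OF sm] unfolding h_def by (simp only: eventually_all_finite simp_thms)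
  ultimately have diff: "\<forall>\<^sub>F x in nhds 0. norm (jacobian f (at x) - jacobian g (at x))
      \<le> (\<Sum>i::'n\<in>UNIV. \<Sum>j\<in>UNIV. C j) * norm x ^ Suc m"
  proof eventually_elim
    case (elim x)
    have "\<bar>(jacobian f (at x) - jacobian g (at x)) $ i $ j\<bar> \<le> C j * norm x ^ Suc m" for i j
    proof -
      have "(jacobian f (at x) - jacobian g (at x)) $ i $ j = pderivs [j] h x $ i"
        using elim(2) by (simp add: jacobian_entry)
      then show ?thesis using elim(1) component_le_norm_cart order_trans by metis
    qed
    then have "(\<Sum>i\<in>UNIV. \<Sum>j\<in>UNIV. \<bar>(jacobian f (at x) - jacobian g (at x)) $ i $ j\<bar>)
        \<le> (\<Sum>i::'n\<in>UNIV. \<Sum>j\<in>UNIV. C j * norm x ^ Suc m)"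
      by (intro sum_mono)
    then show ?case
      unfolding sum_distrib_right by (rule order_trans[OF norm_matrix_le])
  qed
  let ?A = "jacobian f (at 0)"
  have "jacobian f (at 0) = jacobian g (at 0)"
    using eventually_nhds_x_imp_x[OF diff] by simp
  then have lim: "((\<lambda>x. jacobian f (at x)) \<longlongrightarrow> ?A) (nhds 0)" "((\<lambda>x. jacobian g (at x)) \<longlongrightarrow> ?A) (nhds 0)"
    using tendsto_jacobian[OF f filterlim_ident] tendsto_jacobian[OF g filterlim_ident] by simp_all
  obtain \<delta> L where L: "\<delta> > 0" "L \<ge> 0"
    "\<And>M N. M \<in> ball ?A \<delta> \<Longrightarrow> N \<in> ball ?A \<delta> \<Longrightarrow> norm (det M - det N) \<le> L * norm (M - N)"
    using smooth_at_lipschitz[OF smooth_at_det[of ?A]] by blast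
  have "\<forall>\<^sub>F x in nhds 0. \<bar>jacobian_det f x - jacobian_det g x\<bar> \<le> L * (\<Sum>i::'n\<in>UNIV. \<Sum>j\<in>UNIV. C j) * norm x ^ Suc m"
    using diff tendstoD[OF lim(1) L(1)] tendstoD[OF lim(2) L(1)]
  proof eventually_elim
    case (elim x)
    have "\<bar>jacobian_det f x - jacobian_det g x\<bar> \<le> L * norm (jacobian f (at x) - jacobian g (at x))"
      using L(3)[of "jacobian f (at x)" "jacobian g (at x)"] elim(2,3)
      by (simp add: jacobian_det_def dist_commute)
    also have "\<dots> \<le> L * ((\<Sum>i::'n\<in>UNIV. \<Sum>j\<in>UNIV. C j) * norm x ^ Suc m)"
      by (rule mult_left_mono[OF elim(1) L(2)])
    finally show ?case by (simp only: mult.assoc)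
  qed
  then show "\<exists>C. \<forall>\<^sub>F x in nhds 0. \<bar>jacobian_det f x - jacobian_det g x\<bar> \<le> C * norm x ^ Suc m" ..
qed

lemma smooth_germ_bound:
  assumes "smooth_germ f"
  obtains L where "\<forall>\<^sub>F x in nhds 0. norm (f x) \<le> L * norm x" "L \<ge> 0"
proof -
  obtain \<delta> L where L: "\<delta> > 0" "L \<ge> 0"
    "\<And>x y. x \<in> ball 0 \<delta> \<Longrightarrow> y \<in> ball 0 \<delta> \<Longrightarrow> norm (f x - f y) \<le> L * norm (x - y)"
    using assms smooth_at_lipschitz[of f 0] by (auto simp: smooth_germ_iff)
  have "norm (f x) \<le> L * norm x" if "dist x 0 < \<delta>" for x
    using L(3)[of x 0] L(1) that assms by (simp add: smooth_germ_iff)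
  then have "\<forall>\<^sub>F x in nhds 0. norm (f x) \<le> L * norm x"
    unfolding eventually_nhds_metric using L(1) by blast
  then show ?thesis using that L(2) by blast
qed

lemma quotient_null:
  fixes p :: "real \<Rightarrow> real"
  assumes "\<forall>\<^sub>F t in at 0. \<bar>p t\<bar> \<le> C * \<bar>t\<bar> ^ Suc m"
  shows "((\<lambda>t. p t / t ^ m) \<longlongrightarrow> 0) (at 0)"
proof (rule Lim_null_comparison)
  have "((\<lambda>t. C * \<bar>t\<bar>) \<longlongrightarrow> C * \<bar>0\<bar>) (at (0::real))" by (intro tendsto_intros)
  then show "((\<lambda>t. C * \<bar>t\<bar>) \<longlongrightarrow> 0) (at (0::real))" by simp
  show "\<forall>\<^sub>F t in at 0. norm (p t / t ^ m) \<le> C * \<bar>t\<bar>"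
    using assms eventually_neq_at_within[of 0 0 UNIV]
  proof eventually_elim
    case (elim t)
    have "\<bar>p t\<bar> \<le> C * \<bar>t\<bar> * \<bar>t ^ m\<bar>" using elim(1) by (simp add: power_abs mult_ac)
    then show ?case using elim(2) by (simp add: divide_le_eq)
  qed
qed

text \<open>Write \<open>f\<^sup>\<plusminus>\<close> for the normal form with \<open>\<epsilon> = \<plusminus>1\<close>, and put \<open>F = T \<circ> f\<^sup>+ \<circ> S\<close> and
  \<open>\<gamma>(t) = S\<^sup>-\<^sup>1(t e\<^sub>1)\<close>. Then \<open>F(\<gamma>(t)) = T(t\<^sup>k\<^sup>+\<^sup>1 e\<^sub>1)\<close>, and \<open>F\<close> agrees with \<open>f\<^sup>-\<close> to order \<open>k + 1\<close>, so
  all components of \<open>\<gamma>\<close> but the first are \<open>O(t\<^sup>k\<^sup>+\<^sup>1)\<close>. Along \<open>\<gamma>\<close> the Jacobian determinant of \<open>f\<^sup>-\<close> is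
  therefore \<open>-(k + 1) \<alpha>\<^sup>k t\<^sup>k\<close> to leading order, while that of \<open>F\<close> is a positive multiple of \<open>t\<^sup>k\<close>.\<close>

lemma morin_forms_not_jet_conjugate:
  fixes S T :: "real^'n::{finite,linorder} \<Rightarrow> real^'n::{finite,linorder}"
  assumes k: "2 \<le> k" "k \<le> CARD('n)" "even k" and r: "k + 1 \<le> r"
    and S: "positive_germ S" and T: "positive_germ T"
    and jets: "jet r (morin_form k (- 1)) = jet r (\<lambda>x. T (morin_form k 1 (S x)))"
  shows False
proof -
  let ?gp = "morin_form k 1 :: real^'n::{finite,linorder} \<Rightarrow> real^'n::{finite,linorder}"
  let ?gm = "morin_form k (- 1) :: real^'n::{finite,linorder} \<Rightarrow> real^'n::{finite,linorder}"
  define F where "F = (\<lambda>x. T (?gp (S x)))"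
  obtain \<rho> where \<rho>: "positive_germ \<rho>" "\<forall>\<^sub>F x in nhds 0. S (\<rho> x) = x"
    by (rule positive_germ_inverse[OF S])
  note smooth = positive_germ_smooth[OF S] positive_germ_smooth[OF T] positive_germ_smooth[OF \<rho>(1)]
  have F: "smooth_germ F"
    unfolding F_def by (intro smooth_germ_compose[OF smooth(2)] smooth_germ_compose[OF smooth_germ_morin_form] smooth(1))
  have conj: "\<forall>\<^sub>F y in nhds 0. F (\<rho> y) = T (?gp y)"
    using \<rho>(2) by eventually_elim (simp add: F_def)
  define u where "u = (\<lambda>t. t *\<^sub>R axis (ix 1) 1 :: real^'n::{finite,linorder})"
  define \<gamma> where "\<gamma> = (\<lambda>t. \<rho> (u t))"
  have u_lim: "(u \<longlongrightarrow> 0) (at 0)" unfolding u_def by (rule at_le_nhds[OF tendsto_axis])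
  have \<gamma>_lim: "(\<gamma> \<longlongrightarrow> 0) (at 0)"
    unfolding \<gamma>_def by (rule filterlim_compose[OF smooth_germ_tendsto[OF smooth(3)] u_lim])
  have u_smooth: "smooth_at u 0"
    unfolding u_def by (rule smooth_at_linear) (rule bounded_linear_scaleR_left)
  have \<gamma>: "smooth_at \<gamma> 0" "\<gamma> 0 = 0"
    unfolding \<gamma>_def using smooth(3) smooth_at_compose[OF u_smooth, where f=\<rho>]
    by (simp_all add: u_def smooth_germ_iff)
  obtain C where C: "\<forall>\<^sub>F x in nhds 0. \<bar>jacobian_det ?gm x - jacobian_det F x\<bar> \<le> C * norm x ^ Suc k"
    using jacobian_det_flat_difference(1)[OF smooth_germ_morin_form F, of r k "- 1" k] jets r by (auto simp: F_def)
  obtain C' where C': "\<forall>\<^sub>F x in nhds 0. norm (?gm x - F x) \<le> C' * norm x ^ Suc k"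
    using jacobian_det_flat_difference(2)[OF smooth_germ_morin_form F, of r k "- 1" k] jets r by (auto simp: F_def)
  obtain L where L: "\<forall>\<^sub>F x in nhds 0. norm (\<rho> x) \<le> L * norm x" "L \<ge> 0"
    by (rule smooth_germ_bound[OF smooth(3)])
  obtain L' where L': "\<forall>\<^sub>F x in nhds 0. norm (T x) \<le> L' * norm x" "L' \<ge> 0"
    by (rule smooth_germ_bound[OF smooth(2)])
  have \<gamma>_bound: "\<forall>\<^sub>F t in at 0. norm (\<gamma> t) ^ Suc k \<le> L ^ Suc k * \<bar>t\<bar> ^ Suc k"
    using eventually_compose_filterlim[OF L(1) u_lim]
  proof eventually_elim
    case (elim t)
    then have "norm (\<gamma> t) \<le> L * \<bar>t\<bar>" by (simp add: \<gamma>_def u_def)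
    then have "norm (\<gamma> t) ^ Suc k \<le> (L * \<bar>t\<bar>) ^ Suc k" by (intro power_mono) simp_all
    then show ?case by (simp only: power_mult_distrib)
  qed
  \<comment> \<open>The constants in the two difference bounds may be negative, hence the absolute
    value.\<close>
  have scale: "x \<le> \<bar>B\<bar> * L ^ Suc k * \<bar>t\<bar> ^ Suc k"
    if "norm (\<gamma> t) ^ Suc k \<le> L ^ Suc k * \<bar>t\<bar> ^ Suc k" "x \<le> B * norm (\<gamma> t) ^ Suc k" for x B t
  proof -
    have "x \<le> \<bar>B\<bar> * norm (\<gamma> t) ^ Suc k"
      using that(2) by (rule order_trans) (intro mult_right_mono, simp_all)
    also have "\<dots> \<le> \<bar>B\<bar> * (L ^ Suc k * \<bar>t\<bar> ^ Suc k)" by (rule mult_left_mono[OF that(1)]) simp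
    finally show ?thesis by (simp only: mult.assoc)
  qed
  have component: "((\<lambda>t. \<gamma> t $ j / t ^ k) \<longlongrightarrow> 0) (at 0)" if j: "j \<noteq> ix 1" for j
  proof (rule quotient_null)
    have "((\<lambda>t. ?gp (u t)) \<longlongrightarrow> 0) (at 0)"
      by (rule filterlim_compose[OF smooth_germ_tendsto[OF smooth_germ_morin_form] u_lim])
    from eventually_compose_filterlim[OF L'(1) this]
      eventually_compose_filterlim[OF C' \<gamma>_lim] \<gamma>_bound
      eventually_compose_filterlim[OF conj u_lim]
    show "\<forall>\<^sub>F t in at 0. \<bar>\<gamma> t $ j\<bar> \<le> (L' + \<bar>C'\<bar> * L ^ Suc k) * \<bar>t\<bar> ^ Suc k"
    proof eventually_elim
      case (elim t)
      have gpu: "?gp (u t) = t ^ Suc k *\<^sub>R axis (ix 1) 1"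
      proof -
        have "morin_poly k (u t) = t ^ (k + 1)" by (simp only: u_def morin_axis[OF k(2)])
        moreover have "u t $ i = 0" if "i \<noteq> ix 1" for i using that by (simp add: u_def axis_def)
        ultimately show ?thesis by (auto simp: vec_eq_iff morin_form_def axis_def)
      qed
      have "\<bar>\<gamma> t $ j\<bar> = \<bar>?gm (\<gamma> t) $ j\<bar>" using j by (simp add: morin_form_def)
      also have "\<dots> = \<bar>F (\<gamma> t) $ j + (?gm (\<gamma> t) - F (\<gamma> t)) $ j\<bar>" by simp
      also have "\<dots> \<le> norm (F (\<gamma> t)) + norm (?gm (\<gamma> t) - F (\<gamma> t))"
        by (rule order_trans[OF abs_triangle_ineq]) (intro add_mono component_le_norm_cart)
      also have "\<dots> \<le> L' * \<bar>t\<bar> ^ Suc k + \<bar>C'\<bar> * L ^ Suc k * \<bar>t\<bar> ^ Suc k"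
      proof (rule add_mono)
        show "norm (F (\<gamma> t)) \<le> L' * \<bar>t\<bar> ^ Suc k"
          using elim(1,4) by (simp add: \<gamma>_def gpu power_abs abs_mult)
        show "norm (?gm (\<gamma> t) - F (\<gamma> t)) \<le> \<bar>C'\<bar> * L ^ Suc k * \<bar>t\<bar> ^ Suc k"
          by (rule scale[OF elim(3,2)])
      qed
      finally show ?case by (simp only: distrib_right)
    qed
  qed
  define p where "p = (\<lambda>t. \<gamma> t $ ix 1)"
  define \<alpha> where "\<alpha> = real_deriv p 0"
  have "smooth_at p 0" unfolding p_def by (rule smooth_at_nth[OF \<gamma>(1)])
  then have "((\<lambda>t. p t / t ^ 1) \<longlongrightarrow> (real_deriv ^^ 1) p 0 / fact 1) (at 0)"
    by (rule quotient_limit_Taylor) (simp add: p_def \<gamma>(2))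
  then have p: "((\<lambda>t. \<gamma> t $ ix 1 / t) \<longlongrightarrow> \<alpha>) (at 0)"
    by (simp add: \<alpha>_def p_def)
  have \<gamma>1: "((\<lambda>t. \<gamma> t $ ix 1) \<longlongrightarrow> 0) (at 0)"
    using tendsto_vec_nth[OF \<gamma>_lim, of "ix 1"] by simp
  have "((\<lambda>t. (\<Sum>j=2..k. real (j - 1) * \<gamma> t $ ix 1 ^ (j - 2) * (\<gamma> t $ ix j / t ^ k))
      + real (k + 1) * (\<gamma> t $ ix 1 / t) ^ k) \<longlongrightarrow>
      (\<Sum>j=2..k. real (j - 1) * 0 ^ (j - 2) * 0) + real (k + 1) * \<alpha> ^ k) (at 0)"
  proof (intro tendsto_add tendsto_sum tendsto_mult tendsto_const tendsto_power p \<gamma>1 component)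
    fix j assume "j \<in> {2..k}"
    then show "(ix j :: 'n) \<noteq> ix 1" using k by (subst ix_eq_iff) auto
  qed
  \<comment> \<open>Dividing by t^k termwise: the terms with j from 2 to k vanish in the limit by
    \<open>component\<close>, and only the pure power of x_1 contributes.\<close>
  moreover have "(\<Sum>j=2..k. real (j - 1) * \<gamma> t $ ix 1 ^ (j - 2) * (\<gamma> t $ ix j / t ^ k))
      + real (k + 1) * (\<gamma> t $ ix 1 / t) ^ k = morin_slope k (\<gamma> t) / t ^ k" for t
    by (simp add: morin_slope_def add_divide_distrib sum_divide_distrib power_divide)
  ultimately have slope: "((\<lambda>t. morin_slope k (\<gamma> t) / t ^ k) \<longlongrightarrow> real (k + 1) * \<alpha> ^ k) (at 0)"
    by simp
  have "((\<lambda>t. (jacobian_det ?gm (\<gamma> t) - jacobian_det F (\<gamma> t)) / t ^ k) \<longlongrightarrow> 0) (at 0)"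
  proof (rule quotient_null)
    show "\<forall>\<^sub>F t in at 0. \<bar>jacobian_det ?gm (\<gamma> t) - jacobian_det F (\<gamma> t)\<bar> \<le> \<bar>C\<bar> * L ^ Suc k * \<bar>t\<bar> ^ Suc k"
      using eventually_compose_filterlim[OF C \<gamma>_lim] \<gamma>_bound by eventually_elim (rule scale)
  qed
  moreover have "((\<lambda>t. jacobian_det F (\<gamma> t) / t ^ k) \<longlongrightarrow>
      jacobian_det T 0 * (1 * real (k + 1)) / jacobian_det \<rho> 0) (at 0)"
    unfolding \<gamma>_def u_def by (rule jacobian_det_along_axis[OF k(2) F \<rho>(1) T conj])
  ultimately have "((\<lambda>t. (jacobian_det ?gm (\<gamma> t) - jacobian_det F (\<gamma> t)) / t ^ k + jacobian_det F (\<gamma> t) / t ^ k) \<longlongrightarrow>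
      0 + jacobian_det T 0 * (1 * real (k + 1)) / jacobian_det \<rho> 0) (at 0)"
    by (rule tendsto_add)
  then have "((\<lambda>t. - (morin_slope k (\<gamma> t) / t ^ k)) \<longlongrightarrow>
      jacobian_det T 0 * real (k + 1) / jacobian_det \<rho> 0) (at 0)"
    by (simp add: jacobian_det_morin_form[OF k(2)] diff_divide_distrib)
  with tendsto_minus[OF slope]
  have "- (real (k + 1) * \<alpha> ^ k) = jacobian_det T 0 * real (k + 1) / jacobian_det \<rho> 0"
    by (rule LIM_unique)
  moreover have "jacobian_det T 0 * real (k + 1) / jacobian_det \<rho> 0 > 0"
    using \<rho>(1) T by (simp add: positive_germ_def)
  \<comment> \<open>Evenness of \<open>k\<close> decides the sign: the left side of the equation is
    at most 0, while the right side is positive because \<open>T\<close> and \<rho> preserve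
    orientation.\<close>
  moreover have "real (k + 1) * \<alpha> ^ k \<ge> 0" using k(3) by (simp add: zero_le_even_power)
  ultimately show False by linarith
qed

section \<open>Correcting orientations\<close>

text \<open>Converts a linear relation between normal forms into a new pair of coordinate changes
  for the same \<open>f\<close>, and records how the two orientations change.\<close>

lemma linear_twist:
  fixes f h h' \<sigma> \<tau> :: "real^'m::finite \<Rightarrow> real^'m"
  assumes "diffeo_germ \<sigma>" "diffeo_germ \<tau>" "\<forall>\<^sub>F x in nhds 0. h x = \<tau> (f (\<sigma> x))"
    and "smooth_germ f" "det A \<noteq> 0" "det B \<noteq> 0" "\<And>x. h' x = B *v h (A *v x)"
  obtains S T where "diffeo_germ S" "diffeo_germ T" "\<forall>\<^sub>F x in nhds 0. h' x = T (f (S x))"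
    "jacobian_det S 0 = jacobian_det \<sigma> 0 * det A" "jacobian_det T 0 = det B * jacobian_det \<tau> 0"
proof
  show "diffeo_germ (\<lambda>x. \<sigma> (A *v x))" "diffeo_germ (\<lambda>y. B *v \<tau> y)"
    by (rule diffeo_germ_compose[OF assms(1) diffeo_germ_linear[OF assms(5)]],
        rule diffeo_germ_compose[OF diffeo_germ_linear[OF assms(6)] assms(2)])
  have "\<forall>\<^sub>F x in nhds 0. h (A *v x) = \<tau> (f (\<sigma> (A *v x)))"
    by (rule eventually_smooth_germ[OF diffeo_germ_smooth[OF diffeo_germ_linear[OF assms(5)]] assms(3)])
  then show "\<forall>\<^sub>F x in nhds 0. h' x = B *v \<tau> (f (\<sigma> (A *v x)))"
    by eventually_elim (simp add: assms(7))
  have lin: "(\<lambda>x. M *v x) differentiable (at p)" for M :: "real^'m^'m" and p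
    by (rule differentiableI) (rule bounded_linear_imp_has_derivative[OF matrix_vector_mul_bounded_linear])
  show "jacobian_det (\<lambda>x. \<sigma> (A *v x)) 0 = jacobian_det \<sigma> 0 * det A"
    using jacobian_det_compose[OF lin, of \<sigma> A 0] diffeo_germ_differentiable[OF assms(1)]
    by (simp add: jacobian_det_linear)
  show "jacobian_det (\<lambda>y. B *v \<tau> y) 0 = det B * jacobian_det \<tau> 0"
    using jacobian_det_compose[OF diffeo_germ_differentiable[OF assms(2)] lin, of B]
    by (simp add: jacobian_det_linear)
qed

lemma det_reflection: "det (reflection i) = -1"
  by (simp add: det_diag_mat fun_upd_def)

lemma morin_form_spare_reflection:
  fixes x :: "real^'n::{finite,linorder}"
  assumes "1 \<le> k" "k < CARD('n)"
  shows "morin_form k \<epsilon> x = reflection (ix CARD('n)) *v morin_form k \<epsilon> (reflection (ix CARD('n)) *v x)"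
proof -
  let ?R = "reflection (ix CARD('n)) *v x"
  have ix: "?R $ ix j = x $ ix j" if "j \<in> {1..k}" for j
  proof -
    have "(ix j :: 'n) \<noteq> ix CARD('n)" using that assms by (subst ix_eq_iff) auto
    then show ?thesis by (simp add: diag_mat_mult_vec)
  qed
  have "morin_poly k ?R = morin_poly k x"
    unfolding morin_poly_def using ix[of 1] ix assms(1) by (simp del: One_nat_def)
  moreover have "(ix 1 :: 'n) \<noteq> ix CARD('n)" using assms by (subst ix_eq_iff) auto
  ultimately show ?thesis
    by (auto simp: vec_eq_iff diag_mat_mult_vec morin_form_def simp del: One_nat_def)
qed

text \<open>A positive product means that both changes preserve or both reverse orientation; the
  spare reflection repairs the second case. What can obstruct is thus a single sign, that of the
  product.\<close>

lemma morin_form_positive_conjugate: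
  fixes f \<sigma> \<tau> :: "real^'n::{finite,linorder} \<Rightarrow> real^'n::{finite,linorder}"
  assumes k: "1 \<le> k" "k < CARD('n)" and f: "smooth_germ f"
    and \<sigma>: "diffeo_germ \<sigma>" and \<tau>: "diffeo_germ \<tau>" "jacobian_det \<sigma> 0 * jacobian_det \<tau> 0 > 0"
    and conj: "\<forall>\<^sub>F x in nhds 0. morin_form k \<epsilon> x = \<tau> (f (\<sigma> x))"
  shows "\<exists>S T. positive_germ S \<and> positive_germ T \<and> (\<forall>\<^sub>F x in nhds 0. morin_form k \<epsilon> x = T (f (S x)))"
proof (cases "jacobian_det \<sigma> 0 > 0")
  case True
  then have "jacobian_det \<tau> 0 > 0" using \<tau>(2) by (simp add: zero_less_mult_iff)
  then show ?thesis using True \<sigma> \<tau>(1) conj unfolding positive_germ_def by blast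
next
  case False
  then have neg: "jacobian_det \<sigma> 0 < 0" "jacobian_det \<tau> 0 < 0"
    using \<tau>(2) by (auto simp: zero_less_mult_iff)
  let ?R = "reflection (ix CARD('n)) :: real^'n::{finite,linorder}^'n::{finite,linorder}"
  have R: "det ?R \<noteq> 0" by (simp add: det_reflection)
  obtain S T where "diffeo_germ S" "diffeo_germ T" "\<forall>\<^sub>F x in nhds 0. morin_form k \<epsilon> x = T (f (S x))"
    "jacobian_det S 0 = jacobian_det \<sigma> 0 * det ?R" "jacobian_det T 0 = det ?R * jacobian_det \<tau> 0"
    by (rule linear_twist[OF \<sigma> \<tau>(1) conj f R R morin_form_spare_reflection[OF k]])
  then show ?thesis using neg unfolding positive_germ_def det_reflection by force
qed

text \<open>For odd \<open>k\<close> the substitution \<open>x\<^sub>1 \<mapsto> -x\<^sub>1\<close>, \<open>x\<^sub>j \<mapsto> (-1)\<^sup>j\<^sup>-\<^sup>1 x\<^sub>j\<close> preserves the first component, so source and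
  target are changed by diagonal matrices whose determinants have opposite signs.\<close>

lemma morin_form_odd_symmetry:
  assumes "odd k" "k \<le> CARD('n::{finite,linorder})"
  obtains A B :: "real^'n::{finite,linorder}^'n::{finite,linorder}"
  where "det A = - det B" "det B \<noteq> 0" "\<And>x. morin_form k \<epsilon> x = B *v morin_form k \<epsilon> (A *v x)"
proof -
  define e where "e = (\<lambda>i :: 'n. if \<exists>j\<in>{2..k}. even j \<and> i = ix j then - 1 else 1 :: real)"
  \<comment> \<open>\<open>a\<close> and \<open>b\<close> agree away from the first coordinate and
    have opposite signs there, hence opposite determinants. Elsewhere their product is 1, so the
    remaining components are restored.\<close>
  define a where "a = e(ix 1 := - 1)"
  define b where "b = e(ix 1 := 1)"
  have e: "e (ix j) = (- 1) ^ (j - 1) \<and> a (ix j) = e (ix j)" if "j \<in> {2..k}" for j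
  proof -
    have "(ix j :: 'n) = ix i \<longleftrightarrow> j = i" if "i \<in> {1..k}" for i
      using that \<open>j \<in> {2..k}\<close> assms(2) by (intro ix_eq_iff) auto
    from this[of 1] this that have "a (ix j) = e (ix j)" "e (ix j) = (if even j then - 1 else 1)"
      by (auto simp: a_def e_def)
    then show ?thesis using that by (cases "even j") (auto simp: minus_one_power_iff)
  qed
  have "morin_poly k (diag_mat a *v x) = morin_poly k x" for x
  proof -
    have "(diag_mat a *v x) $ ix 1 ^ (j - 1) * (diag_mat a *v x) $ ix j = x $ ix 1 ^ (j - 1) * x $ ix j"
      if "j \<in> {2..k}" for j
    proof -
      have "(diag_mat a *v x) $ ix 1 ^ (j - 1) * (diag_mat a *v x) $ ix j
          = ((- 1) ^ (j - 1) * (- 1) ^ (j - 1)) * (x $ ix 1 ^ (j - 1) * x $ ix j)"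
        using e[OF that] by (simp add: diag_mat_mult_vec a_def power_minus[of "x $ _"] del: One_nat_def)
      then show ?thesis by (simp add: power_mult_distrib[symmetric])
    qed
    \<comment> \<open>Oddness of \<open>k\<close> enters here: the exponent \<open>k + 1\<close> is
      even, so the sign change of x_1 leaves the top power intact.\<close>
    moreover have "(diag_mat a *v x) $ ix 1 ^ (k + 1) = x $ ix 1 ^ (k + 1)"
      using assms(1) by (simp add: diag_mat_mult_vec a_def)
    ultimately show ?thesis unfolding morin_poly_def by simp
  qed
  moreover have "b i * a i = 1" if "i \<noteq> ix 1" for i using that by (simp add: a_def b_def e_def)
  ultimately have "morin_form k \<epsilon> x = diag_mat b *v morin_form k \<epsilon> (diag_mat a *v x)" for x
    by (simp add: vec_eq_iff diag_mat_mult_vec morin_form_def b_def del: One_nat_def)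
  moreover have "det (diag_mat a) = - det (diag_mat b)"
  proof -
    have "prod a (UNIV - {ix 1}) = prod b (UNIV - {ix 1})"
      by (rule prod.cong) (auto simp: a_def b_def)
    moreover have "a (ix 1) = - 1" "b (ix 1) = 1" by (simp_all add: a_def b_def)
    ultimately show ?thesis
      unfolding det_diag_mat prod.remove[OF finite_class.finite_UNIV UNIV_I, of _ "ix 1"]
      by (simp del: One_nat_def)
  qed
  moreover have "det (diag_mat b) \<noteq> 0"
    by (simp add: det_diag_mat b_def e_def)
  ultimately show ?thesis using that by blast
qed

text \<open>If the product of the two orientation signs is negative, odd \<open>k\<close> allows it
  to be reversed by a symmetry keeping \<epsilon>, while for even \<open>k\<close> it is reversed at
  the price of replacing 1 by -1. This is the source of \<epsilon>.\<close>

lemma morin_singularity_positive_form: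
  fixes f :: "real^'n::{finite,linorder} \<Rightarrow> real^'n::{finite,linorder}"
  assumes k: "1 \<le> k" "k < CARD('n)" and f: "morin_singularity k f"
  shows "\<exists>\<epsilon> S T. \<epsilon> \<in> {1, - 1} \<and> (odd k \<longrightarrow> \<epsilon> = 1) \<and> positive_germ S \<and> positive_germ T \<and>
    (\<forall>\<^sub>F x in nhds 0. morin_form k \<epsilon> x = T (f (S x)))"
proof -
  have fs: "smooth_germ f" and eqv: "A_equivalent f (morin_form k 1)"
    using f by (simp_all add: morin_singularity_def morin_normal_form_eq)
  obtain \<sigma> \<tau> where \<sigma>: "diffeo_germ \<sigma>" and \<tau>: "diffeo_germ \<tau>"
    and conj: "\<forall>\<^sub>F x in nhds 0. morin_form k 1 x = \<tau> (f (\<sigma> x))"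
    using eqv unfolding A_equivalent_def comp_def by blast
  let ?p = "jacobian_det \<sigma> 0 * jacobian_det \<tau> 0"
  have p: "?p \<noteq> 0" using diffeo_germ_jacobian_det[OF \<sigma>] diffeo_germ_jacobian_det[OF \<tau>] by simp
  consider "?p > 0" | "?p < 0" "odd k" | "?p < 0" "even k" using p by linarith
  then show ?thesis
  proof cases
    case 1
    from morin_form_positive_conjugate[OF k fs \<sigma> \<tau> 1 conj] show ?thesis by blast
  next
    case 2
    obtain A B :: "real^'n::{finite,linorder}^'n::{finite,linorder}" where AB: "det A = - det B" "det B \<noteq> 0"
      "\<And>x. morin_form k 1 x = B *v morin_form k 1 (A *v x)"
      using morin_form_odd_symmetry[OF 2(2) less_imp_le[OF k(2)], where \<epsilon>=1] by blast
    have A: "det A \<noteq> 0" using AB by simp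
    obtain S T where
      S: "diffeo_germ S" and T: "diffeo_germ T" and ST: "\<forall>\<^sub>F x in nhds 0. morin_form k 1 x = T (f (S x))"
      "jacobian_det S 0 = jacobian_det \<sigma> 0 * det A" "jacobian_det T 0 = det B * jacobian_det \<tau> 0"
      by (rule linear_twist[OF \<sigma> \<tau> conj fs A AB(2,3)])
    have "jacobian_det S 0 * jacobian_det T 0 = (det B * det B) * - ?p"
      by (simp add: ST AB(1))
    also have "\<dots> > 0" using 2(1) AB(2) not_real_square_gt_zero[of "det B"] by (intro mult_pos_pos[of "det B * det B"]) linarith+
    finally show ?thesis using morin_form_positive_conjugate[OF k fs S T _ ST(1)] by blast
  next
    case 3
    let ?R = "reflection (ix 1) :: real^'n::{finite,linorder}^'n::{finite,linorder}"
    have R: "morin_form k (- 1) x = ?R *v morin_form k 1 (mat 1 *v x)" for x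
      by (simp add: vec_eq_iff diag_mat_mult_vec morin_form_def)
    have dets: "det (mat 1 :: real^'n::{finite,linorder}^'n::{finite,linorder}) \<noteq> 0" "det ?R \<noteq> 0"
      by (simp_all add: det_reflection)
    obtain S T where
      S: "diffeo_germ S" and T: "diffeo_germ T" and ST: "\<forall>\<^sub>F x in nhds 0. morin_form k (- 1) x = T (f (S x))"
      "jacobian_det S 0 = jacobian_det \<sigma> 0 * det (mat 1 :: real^'n::{finite,linorder}^'n::{finite,linorder})"
      "jacobian_det T 0 = det ?R * jacobian_det \<tau> 0"
      by (rule linear_twist[OF \<sigma> \<tau> conj fs dets R])
    have "jacobian_det S 0 * jacobian_det T 0 > 0"
      using 3(1) by (simp add: ST det_reflection)
    from morin_form_positive_conjugate[OF k fs S T this ST(1)] show ?thesis using 3(2) by blast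
  qed
qed

theorem mainTheorem3:
  fixes f \<eta> :: "real^'n::{finite,linorder} \<Rightarrow> real^'n::{finite,linorder}" and k r :: nat
  assumes "1 \<le> k" and "k < CARD('n)"
    and "morin_singularity k f"
    and "null_vector_field f \<eta>"
    and "k + 1 \<le> r"
  shows
    "(k = 1 \<longrightarrow> A_equivalent f (fold_signed 1) \<and> A_isotopic r f (fold_signed 1)) \<and>
     (even k \<longrightarrow>
        (let \<epsilon>\<^sub>1 = sgn ((dir_deriv \<eta> ^^ k) (jacobian_det f) 0) in
           A_equivalent f (morin_signed k \<epsilon>\<^sub>1 1) \<and> A_isotopic r f (morin_signed k \<epsilon>\<^sub>1 1)) \<and>
        \<not> A_isotopic r (morin_signed k 1 1 :: real^'n::{finite,linorder} \<Rightarrow> real^'n::{finite,linorder}) (morin_signed k (- 1) 1)) \<and>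
     (3 \<le> k \<and> odd k \<longrightarrow>
        A_equivalent f (morin_signed k 1 1) \<and> A_isotopic r f (morin_signed k 1 1))"
proof -
  obtain \<epsilon> S T where \<epsilon>: "\<epsilon> \<in> {1, - 1}" "odd k \<Longrightarrow> \<epsilon> = 1"
    and S: "positive_germ S" and T: "positive_germ T"
    and conj: "\<forall>\<^sub>F x in nhds 0. morin_form k \<epsilon> x = T (f (S x))"
    using morin_singularity_positive_form[OF assms(1-3)] by blast
  have iso: "A_equivalent f (morin_form k \<epsilon>)" "A_isotopic r f (morin_form k \<epsilon>)"
    by (rule A_isotopicI[OF S T conj])+
  have fs: "smooth_germ f" using assms(3) by (simp add: morin_singularity_def)
  \<comment> \<open>So far \<epsilon> is only known to exist. Inverting \<open>T\<close> brings the
    conjugacy into the form f o S = T' o (normal form), from which eta^k lambda(0) is \<epsilon>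
    times a positive number, \<open>a ^ k\<close> being positive for even \<open>k\<close>.\<close>
  have sign: "sgn ((dir_deriv \<eta> ^^ k) (jacobian_det f) 0) = \<epsilon>" if k: "even k"
  proof -
    obtain T' where T': "positive_germ T'" "\<forall>\<^sub>F x in nhds 0. T' (T x) = x"
      by (rule positive_germ_inverse[OF T])
    have "\<forall>\<^sub>F x in nhds 0. T' (T (f (S x))) = f (S x)"
      by (rule eventually_smooth_germ[OF smooth_germ_compose[OF fs positive_germ_smooth[OF S]] T'(2)])
    then have conj': "\<forall>\<^sub>F x in nhds 0. f (S x) = T' (morin_form k \<epsilon> x)"
      using conj by eventually_elim simp
    have k2: "2 \<le> k" "k \<le> CARD('n)" using k assms(1,2) by (auto elim: evenE)
    obtain a c where ac: "a \<noteq> 0" "c > 0"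
      "(dir_deriv \<eta> ^^ k) (jacobian_det f) 0 = a ^ k * (\<epsilon> * c)"
      by (rule iterated_dir_deriv_morin[OF k2 fs assms(4) S T'(1) conj'])
    have "a ^ k > 0" using ac(1) k by (simp add: zero_less_power_eq)
    then have "a ^ k * c > 0" using ac(2) by simp
    moreover have "sgn (\<epsilon> * y) = \<epsilon>" if "y > 0" for y using that \<epsilon>(1) by auto
    ultimately show ?thesis unfolding ac(3) mult.left_commute[of "a ^ k"] by blast
  qed
  have "\<not> A_isotopic r (morin_form k 1 :: real^'n::{finite,linorder} \<Rightarrow> real^'n::{finite,linorder}) (morin_form k (- 1))"
    if k: "even k"
  proof
    assume iso': "A_isotopic r (morin_form k 1 :: real^'n::{finite,linorder} \<Rightarrow> real^'n::{finite,linorder}) (morin_form k (- 1))"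
    have "1 \<le> r" using assms(5) by simp
    obtain S T :: "real^'n::{finite,linorder} \<Rightarrow> real^'n::{finite,linorder}"
      where "positive_germ S" "positive_germ T"
        "jet r (morin_form k (- 1)) = jet r (\<lambda>x. T (morin_form k 1 (S x)))"
      by (rule A_isotopicE[OF iso' \<open>1 \<le> r\<close>])
    moreover have "2 \<le> k" "k \<le> CARD('n)" using k assms(1,2) by (auto elim: evenE)
    ultimately show False using morin_forms_not_jet_conjugate[OF _ _ k assms(5)] by blast
  qed
  moreover have "2 \<le> k" if "even k" using that assms(1) by (auto elim: evenE)
  ultimately show ?thesis
    using iso \<epsilon>(2) sign by (auto simp: Let_def morin_signed_eq fold_signed_eq simp del: One_nat_def)
qed

end
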